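(* There exists a continuous function $g:[0,1]\to[0,1]$ with $g(\alpha)\sim1-\alpha$ as $\alpha\to1$ (i.e. $g(\alpha)/(1-\alpha)\to1$ as $\alpha\uparrow1$) such that the following holds. Let $\mathbb{P}\in\mathfrak{P}([0,1])$ be any (unknown) measure, let $X_1,X_2,\dots$ be i.i.d. samples from $\mathbb{P}$, and let $\hat{\mathbb{P}}_N(\omega)$ be the empirical distribution of $X_1,\dots,X_N$. For $\alpha\in[0,1)$ let $$k=\frac12\,\Phi^{-1}\!\left(\frac{1+\alpha}{2}\right),\qquad \hat C_N(\omega;\alpha)=\left\{\mathbb{P}'\in\mathfrak{P}([0,1]):\ \mathcal{W}(\hat{\mathbb{P}}_N(\omega),\mathbb{P}')\le kN^{-1/2}\right\}.$$ Then the random set of measures $\hat C_N(\omega;\alpha)$ is an asymptotic confidence region for $\mathbb{P}$ in the sense that $$\liminf_{N\to\infty}\mathbb{P}^\otimes\big(\mathbb{P}\in\hat C_N(\omega;\alpha)\big)\ge1-g(\alpha).$$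
   Context: $\mathfrak{P}([0,1])$ is the set of Borel probability measures on $[0,1]$. $\Phi$ is the cumulative distribution function of a standard normal random variable. The 1-Wasserstein distance is $\mathcal{W}(\mathbb{P},\tilde{\mathbb{P}})=\inf_{\pi\in\Pi(\mathbb{P},\tilde{\mathbb{P}})}\int|x-y|\,\pi(dx,dy)$, where $\Pi(\mathbb{P},\tilde{\mathbb{P}})$ is the set of probability measures on $[0,1]^2$ with marginals $\mathbb{P}$ and $\tilde{\mathbb{P}}$. $\mathbb{P}^\otimes=\mathbb{P}\otimes\mathbb{P}\otimes\cdots$ is the product measure on $[0,1]^{\mathbb{N}}$, under which the coordinates $X_1,X_2,\dots$ are i.i.d. with law $\mathbb{P}$. The empirical measure is $\hat{\mathbb{P}}_N=\frac1N\sum_{i=1}^N\delta_{X_i}$, with $\delta_x$ the Dirac measure at $x$. *)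

theory Defs
  imports "HOL-Probability.Probability"
begin

definition unit_borel :: "real measure" where
  "unit_borel = restrict_space borel {0..1}"

definition borel_probs :: "real measure set" where
  "borel_probs = space (prob_algebra unit_borel)"

lemma borel_probs_iff:
  "P \<in> borel_probs \<longleftrightarrow> sets P = sets (restrict_space borel {0..1}) \<and> prob_space P"
  by (simp add: borel_probs_def unit_borel_def space_prob_algebra)

definition couplings :: "real measure \<Rightarrow> real measure \<Rightarrow> (real \<times> real) measure set" where
  "couplings P Q =
    {\<pi> \<in> space (prob_algebra (unit_borel \<Otimes>\<^sub>M unit_borel)).
      distr \<pi> unit_borel fst = P \<and> distr \<pi> unit_borel snd = Q}"

text \<open>
  The infimum is taken in the reals. For \<open>P, Q \<in> borel_probs\<close> it is over a nonempty set (see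
  \<open>pair_measure_in_couplings\<close> below) that is bounded below by 0, and the integrand is bounded.
\<close>

definition wasserstein :: "real measure \<Rightarrow> real measure \<Rightarrow> real" where
  "wasserstein P Q = (INF \<pi>\<in>couplings P Q. \<integral>z. \<bar>fst z - snd z\<bar> \<partial>\<pi>)"

text \<open>
  The samples are indexed from 0, so the first \<open>N\<close> of them are \<open>\<omega> 0, \<dots>, \<omega> (N - 1)\<close>.
  For \<open>N = 0\<close> this is the null measure.
\<close>

definition empirical_measure :: "nat \<Rightarrow> (nat \<Rightarrow> real) \<Rightarrow> real measure" where
  "empirical_measure N \<omega> =
    measure_of (space unit_borel) (sets unit_borel)
      (\<lambda>A. ennreal (1 / real N) * (\<Sum>i<N. emeasure (return unit_borel (\<omega> i)) A))"

abbreviation std_normal_cdf :: "real \<Rightarrow> real" where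
  "std_normal_cdf \<equiv> cdf std_normal_distribution"

text \<open>
  The inverse is only used at points of \<open>[1/2, 1)\<close>, where the strictly increasing function
  \<open>std_normal_cdf\<close> attains each value exactly once.
\<close>

definition conf_factor :: "real \<Rightarrow> real" where
  "conf_factor \<alpha> = 1 / 2 * inv std_normal_cdf ((1 + \<alpha>) / 2)"

definition conf_region :: "nat \<Rightarrow> (nat \<Rightarrow> real) \<Rightarrow> real \<Rightarrow> real measure set" where
  "conf_region N \<omega> \<alpha> =
    {P' \<in> borel_probs.
      wasserstein (empirical_measure N \<omega>) P' \<le> conf_factor \<alpha> * real N powr (- 1 / 2)}"

definition iid_law :: "real measure \<Rightarrow> (nat \<Rightarrow> real) measure" where
  "iid_law P = PiM UNIV (\<lambda>_. P)"

lemma pair_measure_in_couplings: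
  assumes "P \<in> borel_probs" "Q \<in> borel_probs"
  shows "P \<Otimes>\<^sub>M Q \<in> couplings P Q"
proof -
  have P: "prob_space P" and sP [measurable_cong]: "sets P = sets unit_borel"
    and Q: "prob_space Q" and sQ [measurable_cong]: "sets Q = sets unit_borel"
    using assms by (auto simp: borel_probs_def space_prob_algebra)
  interpret P: prob_space P by fact
  interpret Q: prob_space Q by fact
  interpret PQ: pair_prob_space P Q ..
  have "distr (P \<Otimes>\<^sub>M Q) unit_borel fst = distr (P \<Otimes>\<^sub>M Q) P fst"
    by (rule distr_cong) (simp_all add: sP)
  also have "\<dots> = P"
    by (rule Q.distr_pair_fst)
  finally have 1: "distr (P \<Otimes>\<^sub>M Q) unit_borel fst = P" .
  have "distr (P \<Otimes>\<^sub>M Q) unit_borel snd = Q"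
  proof (rule measure_eqI)
    fix A assume "A \<in> sets (distr (P \<Otimes>\<^sub>M Q) unit_borel snd)"
    then have A: "A \<in> sets unit_borel" by simp
    then have "snd -` A \<inter> space (P \<Otimes>\<^sub>M Q) = space P \<times> A"
      using sets.sets_into_space[of A Q] by (auto simp: space_pair_measure sQ)
    then show "emeasure (distr (P \<Otimes>\<^sub>M Q) unit_borel snd) A = emeasure Q A"
      using A Q.emeasure_pair_measure_Times[OF sets.top[of P], of A]
      by (simp add: emeasure_distr P.emeasure_space_1 sP sQ)
  qed (simp add: sQ)
  moreover have "sets (P \<Otimes>\<^sub>M Q) = sets (unit_borel \<Otimes>\<^sub>M unit_borel)"
    by (rule sets_pair_measure_cong) (simp_all add: sP sQ)
  ultimately show ?thesis
    using 1 by (auto simp: couplings_def space_prob_algebra PQ.prob_space_axioms)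
qed

lemma emeasure_empirical_measure:
  assumes "A \<in> sets unit_borel"
  shows "emeasure (empirical_measure N \<omega>) A =
    ennreal (1 / real N) * (\<Sum>i<N. indicator A (\<omega> i))"
proof -
  have "emeasure (empirical_measure N \<omega>) A =
      ennreal (1 / real N) * (\<Sum>i<N. emeasure (return unit_borel (\<omega> i)) A)"
    unfolding empirical_measure_def
  proof (rule emeasure_measure_of_sigma)
    show "countably_additive (sets unit_borel)
        (\<lambda>A. ennreal (1 / real N) * (\<Sum>i<N. emeasure (return unit_borel (\<omega> i)) A))"
    proof (rule countably_additiveI)
      fix F :: "nat \<Rightarrow> real set"
      assume F: "range F \<subseteq> sets unit_borel" "disjoint_family F" "\<Union> (range F) \<in> sets unit_borel"
      have "(\<Sum>n. emeasure (return unit_borel (\<omega> i)) (F n)) =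
          emeasure (return unit_borel (\<omega> i)) (\<Union> (range F))" for i
        using F by (intro suminf_emeasure) auto
      then show "(\<Sum>n. ennreal (1 / real N) * (\<Sum>i<N. emeasure (return unit_borel (\<omega> i)) (F n))) =
          ennreal (1 / real N) * (\<Sum>i<N. emeasure (return unit_borel (\<omega> i)) (\<Union> (range F)))"
        by (simp add: ennreal_suminf_cmult suminf_sum)
    qed
  qed (use assms in \<open>auto simp: positive_def sets.sigma_algebra_axioms\<close>)
  with assms show ?thesis by simp
qed

lemma empirical_measure_in_borel_probs:
  assumes "N > 0" "\<And>i. i < N \<Longrightarrow> \<omega> i \<in> {0..1}"
  shows "empirical_measure N \<omega> \<in> borel_probs"
proof -
  have sets: "sets (empirical_measure N \<omega>) = sets unit_borel"
    and space: "space (empirical_measure N \<omega>) = space unit_borel"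
    by (simp_all add: empirical_measure_def)
  have "emeasure (empirical_measure N \<omega>) (space unit_borel) =
      ennreal (1 / real N) * (\<Sum>i<N. indicator {0..1} (\<omega> i))"
    by (subst emeasure_empirical_measure[OF sets.top])
      (simp add: unit_borel_def space_restrict_space)
  also have "(\<Sum>i<N. indicator {0..1} (\<omega> i)) = (\<Sum>i<N. 1 :: ennreal)"
    using assms(2) by (intro sum.cong) auto
  also have "ennreal (1 / real N) * (\<Sum>i<N. 1) = 1"
    using assms(1) by (simp add: ennreal_of_nat_eq_real_of_nat flip: ennreal_mult)
  finally show ?thesis
    by (auto simp: borel_probs_def space_prob_algebra sets space intro!: prob_spaceI)
qed

end

theory Submission
  imports Defs "HOL-Real_Asymp.Real_Asymp"
begin

text \<open>
  Let \<open>F\<close> be the distribution function of the sample and \<open>G\<close> the empirical process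
  \<open>sqrt N (F\<^sub>N - F)\<close>. On the line \<open>sqrt N\<close> times the Wasserstein distance is \<open>\<integral> \<bar>G\<bar>\<close>, so with \<open>z = 2 k\<close>
  one needs \<open>P(\<integral> \<bar>G\<bar> > z / 2) \<le> (1 + o(1)) P(\<bar>Z\<bar> > z)\<close> uniformly in \<open>F\<close>, for \<open>Z\<close> standard normal and
  \<open>z \<rightarrow> \<infinity>\<close>. The critical case is \<open>F = 1/2\<close>.

  If \<open>F\<close> is far from \<open>1/2\<close>, Jensen's inequality for \<open>exp\<close>, with weights proportional to the standard
  deviation of \<open>G\<close>, gives a strictly better Gaussian exponent.
  If \<open>F\<close> is close to \<open>1/2\<close>, compare \<open>\<integral> \<bar>G\<bar>\<close> with \<open>\<bar>I\<bar>\<close>, where \<open>I = \<integral> G\<close> is the normalised sum of the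
  variables \<open>E X - X\<close>, of variance at most \<open>1/4\<close>. The central limit theorem for \<open>I\<close> gives the main term. The
  difference is twice the integral of the part of \<open>\<bar>G\<bar>\<close> with the wrong sign; it is negligible, because
  there \<open>\<bar>I\<bar> + \<bar>G\<bar> = \<bar>I - G\<bar>\<close>, whose standard deviation is at most \<open>1/2\<close> and small for most arguments,
  so that Jensen's inequality can be applied with a large multiple of the wrong part added to \<open>\<bar>I\<bar>\<close>.
\<close>

section \<open>The Wasserstein distance on the unit interval\<close>

text \<open>Quantile functions are real-valued; truncating them yields measurable maps into the unit
  interval at once, without a computation of their range.\<close>

definition clip :: "real \<Rightarrow> real" where "clip x = max 0 (min 1 x)"

lemma clip_measurable [measurable]: "clip \<in> borel \<rightarrow>\<^sub>M unit_borel"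
  unfolding unit_borel_def by (rule measurable_restrict_space2) (auto simp: clip_def[abs_def])

lemma clip_le_iff: "0 \<le> t \<Longrightarrow> t < 1 \<Longrightarrow> clip x \<le> t \<longleftrightarrow> x \<le> t"
  by (auto simp: clip_def)

lemma clip_id: "x \<in> {0..1} \<Longrightarrow> clip x = x"
  by (auto simp: clip_def)

lemma space_unit_borel [simp]: "space unit_borel = {0..1}"
  by (simp add: unit_borel_def space_restrict_space)

lemma id_unit_borel_measurable [measurable]: "(\<lambda>x. x) \<in> unit_borel \<rightarrow>\<^sub>M borel"
  unfolding unit_borel_def by (rule measurable_restrict_space1) simp

lemma borel_probsD:
  assumes "P \<in> borel_probs"
  shows "prob_space P" "sets P = sets unit_borel" "space P = {0..1}"
proof -
  show 1: "prob_space P" "sets P = sets unit_borel"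
    using assms by (auto simp: borel_probs_def space_prob_algebra)
  from sets_eq_imp_space_eq[OF 1(2)] show "space P = {0..1}" by simp
qed

section \<open>The unit interval as a probability space\<close>

text \<open>A probability measure on all of R: integrals over the unit interval become expectations,
  bounded measurable functions are integrable, and \<open>pair_prob_space\<close> supplies
  Fubini.\<close>

abbreviation unif01 :: "real measure" where
  "unif01 \<equiv> uniform_measure lborel {0..1}"

lemma measurable_unif01 [simp]: "measurable unif01 N = measurable borel N"
  by (rule measurable_cong_sets) simp_all

lemma prob_space_unif01: "prob_space unif01"
  by (rule prob_space_uniform_measure) auto

interpretation unif01: prob_space unif01
  by (rule prob_space_unif01)

text \<open>The level 1 is left out because truncation spoils the comparison there: every truncated
  value is at most 1.\<close>

lemma AE_unif01: "AE t in unif01. 0 \<le> t \<and> t < 1"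
proof -
  have "AE t in lborel. t \<noteq> (1::real)" by (rule AE_lborel_singleton)
  then show ?thesis
    by (intro AE_uniform_measureI) (auto elim!: eventually_mono)
qed

lemma integral_unif01_indicator_ge:
  assumes "x \<in> {0..1}"
  shows "(\<integral>t. indicat_real {x..} t \<partial>unif01) = 1 - x"
proof -
  have "{0..1} \<inter> {x..} = {x..1}" using assms by auto
  then have "measure unif01 {x..} = 1 - x"
    using assms by simp
  then show ?thesis by simp
qed

text \<open>Layer cake: the two indicators differ exactly for t from the smaller of the two points
  up to, but not including, the larger.\<close>

lemma abs_diff_eq_integral_indicator:
  assumes "x \<in> {0..1}" "y \<in> {0..1}"
  shows "\<bar>x - y\<bar> = (\<integral>t. \<bar>indicat_real {..t} x - indicat_real {..t} y\<bar> \<partial>unif01)"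
proof -
  have *: "\<bar>x - y\<bar> = (\<integral>t. \<bar>indicat_real {..t} x - indicat_real {..t} y\<bar> \<partial>unif01)"
    if "x \<in> {0..1}" "y \<in> {0..1}" "x \<le> y" for x y :: real
  proof -
    have "(\<integral>t. \<bar>indicat_real {..t} x - indicat_real {..t} y\<bar> \<partial>unif01) =
          (\<integral>t. indicat_real {x..} t - indicat_real {y..} t \<partial>unif01)"
      using that by (intro Bochner_Integration.integral_cong) (auto simp: indicator_def)
    also have "\<dots> = (1 - x) - (1 - y)"
      by (subst Bochner_Integration.integral_diff)
        (simp_all only: integral_unif01_indicator_ge that,
         auto intro!: unif01.integrable_const_bound[where B=1])
    finally show ?thesis using that by simp
  qed
  show ?thesis
  proof (cases "x \<le> y")
    case True then show ?thesis using * assms by blast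
  next
    case False
    then have "\<bar>y - x\<bar> = (\<integral>t. \<bar>indicat_real {..t} y - indicat_real {..t} x\<bar> \<partial>unif01)"
      using * assms by auto
    then show ?thesis by (simp add: abs_minus_commute)
  qed
qed

section \<open>Couplings and distribution functions\<close>

text \<open>A half-line \<open>{..t}\<close> is not a measurable subset of the unit interval, so
  \<open>cdf\<close> cannot be applied to P itself; the push-forward along the identity is a Borel
  measure on R. No inverse is meant by the name.\<close>

abbreviation icdf :: "real measure \<Rightarrow> real \<Rightarrow> real" where
  "icdf P \<equiv> cdf (distr P borel (\<lambda>x. x))"

lemma borel_probs_measurable_id:
  "P \<in> borel_probs \<Longrightarrow> (\<lambda>x. x) \<in> P \<rightarrow>\<^sub>M borel"
  using measurable_cong_sets[OF borel_probsD(2) refl] id_unit_borel_measurable by blast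

lemma real_distribution_borel_probs:
  assumes "P \<in> borel_probs"
  shows "real_distribution (distr P borel (\<lambda>x. x))"
proof -
  interpret prob_space P using assms by (rule borel_probsD)
  show ?thesis by (rule real_distribution_distr) (rule borel_probs_measurable_id[OF assms])
qed

lemma cdf_eq_integral:
  assumes "prob_space M" "X \<in> borel_measurable M"
  shows "cdf (distr M borel X) t = (\<integral>\<omega>. indicat_real {..t} (X \<omega>) \<partial>M)"
proof -
  have "cdf (distr M borel X) t = (\<integral>x. indicat_real {..t} x \<partial>distr M borel X)"
    by (simp add: cdf_def)
  then show ?thesis using assms by (simp only:, subst integral_distr) auto
qed

lemma integral_coupling_swap:
  assumes "sets \<pi> = sets (unit_borel \<Otimes>\<^sub>M unit_borel)" "prob_space \<pi>"
  shows "(\<integral>z. \<bar>fst z - snd z\<bar> \<partial>\<pi>) =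
    (\<integral>t. (\<integral>z. \<bar>indicat_real {..t} (fst z) - indicat_real {..t} (snd z)\<bar> \<partial>\<pi>) \<partial>unif01)"
proof -
  interpret pi: prob_space \<pi> by fact
  interpret pair_prob_space \<pi> unif01 ..
  note assms(1)[measurable_cong]
  have sp: "space \<pi> = {0..1} \<times> {0..1}"
    using sets_eq_imp_space_eq[OF assms(1)] by (simp add: space_pair_measure)
  have m: "fst \<in> borel_measurable \<pi>" "snd \<in> borel_measurable \<pi>"
    by measurable
  note [measurable] = m
  \<comment> \<open>Written as comparisons of coordinates, the indicators of the moving half-lines
    are visibly measurable in the point and the level jointly.\<close>
  have "(\<lambda>p::(real\<times>real)\<times>real. \<bar>indicat_real {..snd p} (fst (fst p)) - indicat_real {..snd p} (snd (fst p))\<bar> :: real)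
     = (\<lambda>p. \<bar>(if fst (fst p) \<le> snd p then 1 else 0) - (if snd (fst p) \<le> snd p then 1 else 0)\<bar>)"
    by (auto simp: indicator_def)
  also have "\<dots> \<in> borel_measurable (\<pi> \<Otimes>\<^sub>M unif01)" by measurable
  finally have meas: "(\<lambda>p. \<bar>indicat_real {..snd p} (fst (fst p)) - indicat_real {..snd p} (snd (fst p))\<bar> :: real)
     \<in> borel_measurable (\<pi> \<Otimes>\<^sub>M unif01)" .
  have int: "integrable (\<pi> \<Otimes>\<^sub>M unif01) (\<lambda>p. \<bar>indicat_real {..snd p} (fst (fst p)) - indicat_real {..snd p} (snd (fst p))\<bar> :: real)"
    by (rule integrable_const_bound[where B = 1]) (auto simp: indicator_def meas)
  have "(\<integral>z. \<bar>fst z - snd z\<bar> \<partial>\<pi>) = (\<integral>z. (\<integral>t. \<bar>indicat_real {..t} (fst z) - indicat_real {..t} (snd z)\<bar> \<partial>unif01) \<partial>\<pi>)"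
    by (intro Bochner_Integration.integral_cong refl abs_diff_eq_integral_indicator) (auto simp: sp)
  also have "\<dots> = (\<integral>t. (\<integral>z. \<bar>indicat_real {..t} (fst z) - indicat_real {..t} (snd z)\<bar> \<partial>\<pi>) \<partial>unif01)"
    using Fubini_integral[of "\<lambda>z t. \<bar>indicat_real {..t} (fst z) - indicat_real {..t} (snd z)\<bar> :: real"] int
    by (simp add: case_prod_beta')
  finally show ?thesis .
qed

lemma couplings_cdf:
  assumes "\<pi> \<in> couplings P Q"
  shows "icdf P t = (\<integral>z. indicat_real {..t} (fst z) \<partial>\<pi>)" "icdf Q t = (\<integral>z. indicat_real {..t} (snd z) \<partial>\<pi>)"
proof -
  have p: "prob_space \<pi>" and s[measurable_cong]: "sets \<pi> = sets (unit_borel \<Otimes>\<^sub>M unit_borel)"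
    and P: "P = distr \<pi> unit_borel fst" and Q: "Q = distr \<pi> unit_borel snd"
    using assms by (auto simp: couplings_def space_prob_algebra)
  have "distr P borel (\<lambda>x. x) = distr \<pi> borel fst" "distr Q borel (\<lambda>x. x) = distr \<pi> borel snd"
    unfolding P Q by (subst distr_distr; simp add: comp_def)+
  then show "icdf P t = (\<integral>z. indicat_real {..t} (fst z) \<partial>\<pi>)" "icdf Q t = (\<integral>z. indicat_real {..t} (snd z) \<partial>\<pi>)"
    by (simp_all add: cdf_eq_integral[OF p])
qed

text \<open>The comonotone coupling: one uniform variable u on (0,1) is sent through both quantile
  functions. At each level t the two events become \<open>u \<le> icdf P t\<close> and
  \<open>u \<le> icdf Q t\<close>; they are nested, so the expected difference of the indicators in
  absolute value is the difference of their probabilities.\<close>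

lemma quantile_coupling:
  assumes P: "P \<in> borel_probs" and Q: "Q \<in> borel_probs"
  obtains \<pi> where "\<pi> \<in> couplings P Q"
    "\<And>t. 0 \<le> t \<Longrightarrow> t < 1 \<Longrightarrow>
      (\<integral>z. \<bar>indicat_real {..t} (fst z) - indicat_real {..t} (snd z)\<bar> \<partial>\<pi>) = \<bar>icdf P t - icdf Q t\<bar>"
proof -
  let ?\<Omega> = "restrict_space lborel {0<..<1} :: real measure"
  interpret P': cdf_distribution "distr P borel (\<lambda>x. x)"
    unfolding cdf_distribution_def by (rule real_distribution_borel_probs[OF P])
  interpret Q': cdf_distribution "distr Q borel (\<lambda>x. x)"
    unfolding cdf_distribution_def by (rule real_distribution_borel_probs[OF Q])
  interpret \<Omega>: prob_space ?\<Omega>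
    by (auto simp: space_restrict_space emeasure_restrict_space intro!: prob_spaceI)
  have [measurable]: "P'.I \<in> borel_measurable ?\<Omega>" "Q'.I \<in> borel_measurable ?\<Omega>"
    using P'.measurable_CI Q'.measurable_CI by (simp_all cong: measurable_cong_sets add: sets_restrict_space)
  define \<pi> where "\<pi> = distr ?\<Omega> (unit_borel \<Otimes>\<^sub>M unit_borel) (\<lambda>u. (clip (P'.I u), clip (Q'.I u)))"
  \<comment> \<open>The quantile function of R carries the uniform law on (0,1) to R, and truncation
    changes nothing because R lives on the unit interval.\<close>
  have marg: "distr ?\<Omega> unit_borel (\<lambda>u. clip (I u)) = R"
    if R: "R \<in> borel_probs" and [measurable]: "I \<in> borel_measurable ?\<Omega>"
      and d: "distr ?\<Omega> borel I = distr R borel (\<lambda>x. x)" for I R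
  proof -
    have "distr ?\<Omega> unit_borel (\<lambda>u. clip (I u)) = distr (distr ?\<Omega> borel I) unit_borel clip"
      by (subst distr_distr) (auto simp: comp_def)
    also have "\<dots> = distr R unit_borel clip"
      unfolding d using borel_probs_measurable_id[OF R] by (subst distr_distr) (auto simp: comp_def)
    also have "\<dots> = distr R R (\<lambda>x. x)"
      using borel_probsD[OF R] by (intro distr_cong) (auto simp: clip_id)
    also have "\<dots> = R" by simp
    finally show ?thesis .
  qed
  have "\<pi> \<in> couplings P Q"
    using marg[OF P _ P'.distr_I_eq_M] marg[OF Q _ Q'.distr_I_eq_M]
    by (auto simp: couplings_def space_prob_algebra \<pi>_def distr_distr comp_def intro!: \<Omega>.prob_space_distr)
  moreover have "(\<integral>z. \<bar>indicat_real {..t} (fst z) - indicat_real {..t} (snd z)\<bar> \<partial>\<pi>) = \<bar>icdf P t - icdf Q t\<bar>"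
    if t: "0 \<le> t" "t < 1" for t
  proof -
    have eq: "(\<integral>z. f (fst z) (snd z) \<partial>\<pi>) = (\<integral>u. f (clip (P'.I u)) (clip (Q'.I u)) \<partial>?\<Omega>)"
      if [measurable]: "(\<lambda>z. f (fst z) (snd z)) \<in> borel_measurable (unit_borel \<Otimes>\<^sub>M unit_borel)"
      for f :: "real \<Rightarrow> real \<Rightarrow> real"
      unfolding \<pi>_def by (subst integral_distr) auto
    \<comment> \<open>Galois property of the pseudoinverse: it is at most t iff u is at most the
      distribution function at t. For t in [0,1) truncation respects this.\<close>
    have ind: "indicat_real {..t} (clip (P'.I u)) = (if u \<le> icdf P t then 1 else 0)"
       "indicat_real {..t} (clip (Q'.I u)) = (if u \<le> icdf Q t then 1 else 0)"
      if "u \<in> space ?\<Omega>" for u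
      using that t P'.pseudoinverse[of u t] Q'.pseudoinverse[of u t]
      by (auto simp: clip_le_iff space_restrict_space)
    \<comment> \<open>By nestedness the difference of the indicators has the same sign for all u, so
      the absolute value is multiplication by one constant.\<close>
    define d where "d = (if icdf P t \<le> icdf Q t then -1 else 1 :: real)"
    have "(\<integral>z. \<bar>indicat_real {..t} (fst z) - indicat_real {..t} (snd z)\<bar> \<partial>\<pi>) =
      (\<integral>u. \<bar>indicat_real {..t} (clip (P'.I u)) - indicat_real {..t} (clip (Q'.I u))\<bar> \<partial>?\<Omega>)"
      by (rule eq) measurable
    also have "\<dots> = (\<integral>u. d * (indicat_real {..t} (clip (P'.I u)) - indicat_real {..t} (clip (Q'.I u))) \<partial>?\<Omega>)"
      by (intro Bochner_Integration.integral_cong) (auto simp: ind d_def)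
    also have "\<dots> = d * ((\<integral>u. indicat_real {..t} (clip (P'.I u)) \<partial>?\<Omega>) - (\<integral>u. indicat_real {..t} (clip (Q'.I u)) \<partial>?\<Omega>))"
      by (subst integral_mult_right_zero, subst Bochner_Integration.integral_diff)
         (auto intro!: \<Omega>.integrable_const_bound[where B=1])
    also have "\<dots> = d * (icdf P t - icdf Q t)"
      using couplings_cdf[OF \<open>\<pi> \<in> couplings P Q\<close>, of t]
        eq[of "\<lambda>x y. indicat_real {..t} x"] eq[of "\<lambda>x y. indicat_real {..t} y"] by simp
    also have "\<dots> = \<bar>icdf P t - icdf Q t\<bar>" by (auto simp: d_def)
    finally show ?thesis .
  qed
  ultimately show ?thesis using that by blast
qed

text \<open>By the layer cake and Fubini the cost of a coupling is the integral over t of the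
  expected absolute difference of the indicators. Moving the absolute value outside the expectation
  bounds every coupling from below, and the quantile coupling attains the bound.\<close>

theorem wasserstein_eq_integral_cdf:
  assumes P: "P \<in> borel_probs" and Q: "Q \<in> borel_probs"
  shows "wasserstein P Q = (\<integral>t. \<bar>icdf P t - icdf Q t\<bar> \<partial>unif01)"
  unfolding wasserstein_def
proof (rule cInf_eq_minimum)
  obtain \<pi> where \<pi>: "\<pi> \<in> couplings P Q"
    and eq: "\<And>t. 0 \<le> t \<Longrightarrow> t < 1 \<Longrightarrow>
      (\<integral>z. \<bar>indicat_real {..t} (fst z) - indicat_real {..t} (snd z)\<bar> \<partial>\<pi>) = \<bar>icdf P t - icdf Q t\<bar>"
    by (rule quantile_coupling[OF P Q]) blast
  interpret P': cdf_distribution "distr P borel (\<lambda>x. x)"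
    unfolding cdf_distribution_def by (rule real_distribution_borel_probs[OF P])
  interpret Q': cdf_distribution "distr Q borel (\<lambda>x. x)"
    unfolding cdf_distribution_def by (rule real_distribution_borel_probs[OF Q])
  have cm[measurable]: "icdf P \<in> borel_measurable borel" "icdf Q \<in> borel_measurable borel"
    using P'.measurable_C Q'.measurable_C .
  have cp: "sets \<rho> = sets (unit_borel \<Otimes>\<^sub>M unit_borel)" "prob_space \<rho>" if "\<rho> \<in> couplings P Q" for \<rho>
    using that by (auto simp: couplings_def space_prob_algebra)
  have mi: "(\<lambda>t. \<integral>z. \<bar>indicat_real {..t} (fst z) - indicat_real {..t} (snd z)\<bar> \<partial>\<rho>) \<in> borel_measurable borel"
    if r: "\<rho> \<in> couplings P Q" for \<rho>
  proof -
    interpret prob_space \<rho> using cp(2)[OF r] .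
    note cp(1)[OF r, measurable_cong]
    have "fst \<in> borel_measurable \<rho>" "snd \<in> borel_measurable \<rho>" by measurable
    note [measurable] = this
    have "(\<lambda>(t, z). \<bar>indicat_real {..t} (fst z) - indicat_real {..t} (snd z)\<bar> :: real) =
      (\<lambda>(t, z). \<bar>(if fst z \<le> t then 1 else 0) - (if snd z \<le> t then 1 else 0)\<bar>)"
      by (auto simp: indicator_def)
    also have "\<dots> \<in> borel_measurable (borel \<Otimes>\<^sub>M \<rho>)" by measurable
    finally show ?thesis by (rule borel_measurable_lebesgue_integral)
  qed
  have "(\<integral>z. \<bar>fst z - snd z\<bar> \<partial>\<pi>) = (\<integral>t. \<bar>icdf P t - icdf Q t\<bar> \<partial>unif01)"
    unfolding integral_coupling_swap[OF cp[OF \<pi>]]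
  proof (rule integral_cong_AE)
    show "AE t in unif01. (\<integral>z. \<bar>indicat_real {..t} (fst z) - indicat_real {..t} (snd z)\<bar> \<partial>\<pi>) = \<bar>icdf P t - icdf Q t\<bar>"
      using AE_unif01 by eventually_elim (rule eq; simp)
  qed (use mi[OF \<pi>] in simp_all)
  then show "(\<integral>t. \<bar>icdf P t - icdf Q t\<bar> \<partial>unif01) \<in> (\<lambda>\<pi>. \<integral>z. \<bar>fst z - snd z\<bar> \<partial>\<pi>) ` couplings P Q"
    using \<pi> by (intro image_eqI[where x=\<pi>]) simp_all
  fix x assume "x \<in> (\<lambda>\<pi>. \<integral>z. \<bar>fst z - snd z\<bar> \<partial>\<pi>) ` couplings P Q"
  then obtain \<rho> where \<rho>: "\<rho> \<in> couplings P Q" and x: "x = (\<integral>z. \<bar>fst z - snd z\<bar> \<partial>\<rho>)" by auto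
  interpret \<rho>: prob_space \<rho> using cp(2)[OF \<rho>] .
  note cp(1)[OF \<rho>, measurable_cong]
  have m: "fst \<in> borel_measurable \<rho>" "snd \<in> borel_measurable \<rho>" by measurable
  note [measurable] = m
  have int: "integrable \<rho> (\<lambda>z. indicat_real {..t} (fst z) :: real)" "integrable \<rho> (\<lambda>z. indicat_real {..t} (snd z) :: real)" for t
    by (auto intro!: \<rho>.integrable_const_bound[where B=1])
  have int2: "\<bar>\<integral>z. \<bar>indicat_real {..t} (fst z) - indicat_real {..t} (snd z)\<bar> \<partial>\<rho>\<bar> \<le> (1::real)" for t
  proof -
    have "(\<integral>z. \<bar>indicat_real {..t} (fst z) - indicat_real {..t} (snd z)\<bar> \<partial>\<rho>) \<le> (1::real)"
      by (rule \<rho>.integral_le_const) (use int in \<open>auto simp: indicator_def\<close>)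
    then show ?thesis by simp
  qed
  have "(\<integral>t. \<bar>icdf P t - icdf Q t\<bar> \<partial>unif01) \<le> x"
    unfolding x integral_coupling_swap[OF cp[OF \<rho>]]
  proof (rule integral_mono)
    show "integrable unif01 (\<lambda>t. \<bar>icdf P t - icdf Q t\<bar>)"
    proof (rule unif01.integrable_const_bound[where B=1])
      show "AE t in unif01. norm \<bar>icdf P t - icdf Q t\<bar> \<le> 1"
        using P'.cdf_nonneg P'.cdf_bounded_prob Q'.cdf_nonneg Q'.cdf_bounded_prob
        by (intro always_eventually) (smt (verit) real_norm_def)
    qed simp
    show "integrable unif01 (\<lambda>t. \<integral>z. \<bar>indicat_real {..t} (fst z) - indicat_real {..t} (snd z)\<bar> \<partial>\<rho>)"
      by (rule unif01.integrable_const_bound[where B=1]) (use int2 mi[OF \<rho>] in auto)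
    fix t
    have "icdf P t - icdf Q t = (\<integral>z. indicat_real {..t} (fst z) - indicat_real {..t} (snd z) \<partial>\<rho>)"
      using int by (simp add: couplings_cdf[OF \<rho>])
    then show "\<bar>icdf P t - icdf Q t\<bar> \<le> (\<integral>z. \<bar>indicat_real {..t} (fst z) - indicat_real {..t} (snd z)\<bar> \<partial>\<rho>)"
      by simp
  qed
  then show "(\<integral>t. \<bar>icdf P t - icdf Q t\<bar> \<partial>unif01) \<le> x" .
qed

lemma icdf_empirical_measure:
  assumes "N > 0" "\<And>i. i < N \<Longrightarrow> \<omega> i \<in> {0..1}"
  shows "icdf (empirical_measure N \<omega>) t = (\<Sum>i<N. indicat_real {..t} (\<omega> i)) / real N"
proof -
  note E = empirical_measure_in_borel_probs[OF assms]
  have s: "{..t} \<inter> {0..1} \<in> sets unit_borel"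
    by (auto simp: unit_borel_def sets_restrict_space)
  have "icdf (empirical_measure N \<omega>) t = measure (empirical_measure N \<omega>) ({..t} \<inter> {0..1})"
    unfolding cdf_def using borel_probs_measurable_id[OF E] borel_probsD[OF E]
    by (subst measure_distr) auto
  also have "\<dots> = enn2real (ennreal (1 / real N) * (\<Sum>i<N. indicator ({..t} \<inter> {0..1}) (\<omega> i)))"
    unfolding measure_def emeasure_empirical_measure[OF s] ..
  also have "(\<Sum>i<N. indicator ({..t} \<inter> {0..1}) (\<omega> i)) = (\<Sum>i<N. ennreal (indicator {..t} (\<omega> i)))"
    using assms(2) by (intro sum.cong) (auto simp: indicator_def)
  also have "\<dots> = ennreal (\<Sum>i<N. indicat_real {..t} (\<omega> i))"
    by (simp add: sum_ennreal)
  finally show ?thesis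
    by (simp add: enn2real_mult sum_nonneg)
qed

declare id_unit_borel_measurable [measurable del]

section \<open>Exponential moments\<close>

text \<open>The Lagrange remainder is \<open>exp t / 6\<close> times the cube of x with |t| at most
  1, and e is less than 6.\<close>

lemma exp_le_cubic_Taylor:
  fixes x :: real
  assumes "\<bar>x\<bar> \<le> 1"
  shows "exp x \<le> 1 + x + x\<^sup>2 / 2 + \<bar>x\<bar> ^ 3"
proof -
  obtain t where t: "\<bar>t\<bar> \<le> \<bar>x\<bar>" "exp x = (\<Sum>m<3. (x ^ m) / fact m) + (exp t / fact 3) * x ^ 3"
    using Maclaurin_exp_le[of x 3] by auto
  have "exp t \<le> exp 1" using t(1) assms by simp
  also have "exp 1 \<le> (6::real)" using exp_le by simp
  finally have "exp t / fact 3 \<le> 1" by (simp add: fact_numeral)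
  moreover have "(exp t / fact 3) * x ^ 3 \<le> (exp t / fact 3) * \<bar>x\<bar> ^ 3"
    by (intro mult_left_mono) (auto simp flip: power_abs)
  ultimately have "(exp t / fact 3) * x ^ 3 \<le> \<bar>x\<bar> ^ 3"
    by (smt (verit) mult_left_le_one_le zero_le_power abs_ge_zero exp_ge_zero fact_ge_zero zero_le_divide_iff)
  then show ?thesis using t(2) by (simp add: numeral_3_eq_3 power2_eq_square)
qed

context prob_space
begin

text \<open>The quadratic term keeps the exact constant 1/2 in front of the variance, on which the
  sharp Gaussian exponent rests; the crude cubic error vanishes after normalisation by sqrt
  N.\<close>

lemma expectation_exp_le:
  fixes Y :: "'a \<Rightarrow> real"
  assumes [measurable]: "Y \<in> borel_measurable M" and B: "\<And>\<omega>. \<omega> \<in> space M \<Longrightarrow> \<bar>Y \<omega>\<bar> \<le> B"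
    and m: "expectation Y = 0" and v: "expectation (\<lambda>\<omega>. (Y \<omega>)\<^sup>2) \<le> v" and t: "\<bar>t\<bar> * B \<le> 1"
  shows "expectation (\<lambda>\<omega>. exp (t * Y \<omega>)) \<le> exp (t\<^sup>2 * v / 2 + \<bar>t\<bar> ^ 3 * B ^ 3)"
proof -
  have tY: "\<bar>t * Y \<omega>\<bar> \<le> \<bar>t\<bar> * B" if "\<omega> \<in> space M" for \<omega>
    unfolding abs_mult using B[OF that] by (rule mult_left_mono) simp
  have i1: "integrable M Y"
    using B by (intro integrable_const_bound[where B=B]) auto
  have i2: "integrable M (\<lambda>\<omega>. (Y \<omega>)\<^sup>2)"
    using B by (intro integrable_const_bound[where B="B\<^sup>2"] AE_I2) (auto simp: abs_le_square_iff[symmetric] intro: order_trans[OF _ abs_ge_self])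
  have ie: "integrable M (\<lambda>\<omega>. exp (t * Y \<omega>))"
    using tY t by (intro integrable_const_bound[where B="exp 1"] AE_I2) (auto, force)
  have "exp (t * Y \<omega>) \<le> 1 + t * Y \<omega> + t\<^sup>2 / 2 * (Y \<omega>)\<^sup>2 + \<bar>t\<bar> ^ 3 * B ^ 3" if "\<omega> \<in> space M" for \<omega>
  proof -
    have "exp (t * Y \<omega>) \<le> 1 + t * Y \<omega> + (t * Y \<omega>)\<^sup>2 / 2 + \<bar>t * Y \<omega>\<bar> ^ 3"
      using tY[OF that] t by (intro exp_le_cubic_Taylor) auto
    also have "\<bar>t * Y \<omega>\<bar> ^ 3 \<le> (\<bar>t\<bar> * B) ^ 3"
      using tY[OF that] by (intro power_mono) auto
    finally show ?thesis by (simp add: power_mult_distrib)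
  qed
  then have "expectation (\<lambda>\<omega>. exp (t * Y \<omega>)) \<le> expectation (\<lambda>\<omega>. 1 + t * Y \<omega> + t\<^sup>2 / 2 * (Y \<omega>)\<^sup>2 + \<bar>t\<bar> ^ 3 * B ^ 3)"
    using i1 i2 ie by (intro integral_mono) auto
  also have "\<dots> = 1 + t\<^sup>2 / 2 * expectation (\<lambda>\<omega>. (Y \<omega>)\<^sup>2) + \<bar>t\<bar> ^ 3 * B ^ 3"
    using i1 i2 by (simp add: m prob_space)
  also have "\<dots> \<le> 1 + (t\<^sup>2 * v / 2 + \<bar>t\<bar> ^ 3 * B ^ 3)"
    using mult_left_mono[OF v, of "t\<^sup>2 / 2"] by simp
  also have "\<dots> \<le> exp (t\<^sup>2 * v / 2 + \<bar>t\<bar> ^ 3 * B ^ 3)" by simp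
  finally show ?thesis .
qed

text \<open>A Chernoff bound for an average over x. Jensen with the probability density p moves
  \<open>exp\<close> under the average and Fubini exchanges it with the expectation, so only
  exponential moments at single points x, bounded uniformly, have to be known.\<close>

lemma prob_weighted_average_gt_le:
  fixes f :: "'a \<Rightarrow> real \<Rightarrow> real"
  assumes f[measurable]: "(\<lambda>(\<omega>, x). f \<omega> x) \<in> borel_measurable (M \<Otimes>\<^sub>M borel)"
    and fR: "\<And>\<omega> x. \<omega> \<in> space M \<Longrightarrow> \<bar>f \<omega> x\<bar> \<le> R"
    and p[measurable]: "p \<in> borel_measurable borel" and p0: "\<And>x. 0 \<le> p x" and pc: "\<And>x. p x \<le> c"
    and p1: "(\<integral>x. p x \<partial>unif01) = 1"
    and l: "0 \<le> l" and C: "\<And>x. expectation (\<lambda>\<omega>. exp (l * f \<omega> x)) \<le> C"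
  shows "prob {\<omega>\<in>space M. t < (\<integral>x. p x * f \<omega> x \<partial>unif01)} \<le> exp (- l * t) * C"
proof -
  interpret MU: pair_prob_space M unif01 ..
  define Q where "Q \<omega> = (\<integral>x. p x * f \<omega> x \<partial>unif01)" for \<omega>
  define E where "E \<omega> = (\<integral>x. p x * exp (l * f \<omega> x) \<partial>unif01)" for \<omega>
  have fm[measurable]: "f \<omega> \<in> borel_measurable borel" if "\<omega> \<in> space M" for \<omega>
    using f that by measurable
  have [measurable]: "(\<lambda>\<omega>. f \<omega> x) \<in> borel_measurable M" for x
    using measurable_Pair1[OF f, of x] by simp
  have meas: "(\<lambda>(\<omega>, x). p x * f \<omega> x) \<in> borel_measurable (M \<Otimes>\<^sub>M unif01)"
    "(\<lambda>(\<omega>, x). p x * exp (l * f \<omega> x)) \<in> borel_measurable (M \<Otimes>\<^sub>M unif01)" by measurable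
  have [measurable]: "Q \<in> borel_measurable M" "E \<in> borel_measurable M"
    unfolding Q_def[abs_def] E_def[abs_def] using meas by (auto intro!: unif01.borel_measurable_lebesgue_integral)
  have eb: "p x * exp (l * f \<omega> x) \<le> c * exp (l * R)" if "\<omega> \<in> space M" for \<omega> x
    using fR[OF that, of x] l p0[of x] pc[of x] by (intro mult_mono) (auto intro!: mult_left_mono)
  have int: "integrable (M \<Otimes>\<^sub>M unif01) (\<lambda>(\<omega>, x). p x * exp (l * f \<omega> x))"
    using eb p0 by (intro MU.integrable_const_bound[where B="c * exp (l * R)"] AE_I2 meas)
      (auto simp: space_pair_measure)
  have ip: "integrable unif01 p"
    using p0 pc by (intro unif01.integrable_const_bound[where B=c]) auto
  have c0: "0 \<le> c" using p0 pc order_trans by blast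
  have if1: "integrable unif01 (\<lambda>x. p x * f \<omega> x)" if "\<omega> \<in> space M" for \<omega>
    using fR[OF that] p0 pc c0 that fm[OF that]
    by (intro unif01.integrable_const_bound[where B="c * R"] AE_I2) (auto simp: abs_mult intro!: mult_mono)
  have if2: "integrable unif01 (\<lambda>x. p x * exp (l * f \<omega> x))" if "\<omega> \<in> space M" for \<omega>
    using eb[OF that] p0 fm[OF that]
    by (intro unif01.integrable_const_bound[where B="c * exp (l * R)"] AE_I2) auto
  have jensen: "exp (l * Q \<omega>) \<le> E \<omega>" if "\<omega> \<in> space M" for \<omega>
  proof -
    define a where "a = l * Q \<omega>"
    \<comment> \<open>Jensen by hand: the tangent of \<open>exp\<close> at
      \<open>a = l * Q \<omega>\<close> lies below \<open>exp\<close>, and integrating the tangent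
      against p gives back \<open>exp a\<close>.\<close>
    have "exp a = exp a * (1 - a) * (\<integral>x. p x \<partial>unif01) + exp a * l * (\<integral>x. p x * f \<omega> x \<partial>unif01)"
      by (simp add: p1 a_def Q_def algebra_simps)
    also have "\<dots> = (\<integral>x. exp a * (1 - a) * p x + exp a * l * (p x * f \<omega> x) \<partial>unif01)"
      using ip if1[OF that] by simp
    also have "\<dots> \<le> E \<omega>"
      unfolding E_def
    proof (intro integral_mono)
      fix x
      have "exp a * (1 + (l * f \<omega> x - a)) \<le> exp a * exp (l * f \<omega> x - a)"
        by (intro mult_left_mono) auto
      also have "\<dots> = exp (l * f \<omega> x)" by (simp flip: exp_add)
      finally show "exp a * (1 - a) * p x + exp a * l * (p x * f \<omega> x) \<le> p x * exp (l * f \<omega> x)"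
        using p0[of x] mult_left_mono[OF _ p0[of x]] by (fastforce simp: algebra_simps)
    qed (use ip if1[OF that] if2[OF that] in auto)
    finally show ?thesis by (simp add: a_def)
  qed
  have iE: "integrable M E"
    unfolding E_def[abs_def] using MU.integrable_fst[OF int] by simp
  have "expectation E = (\<integral>x. (\<integral>\<omega>. p x * exp (l * f \<omega> x) \<partial>M) \<partial>unif01)"
    unfolding E_def[abs_def] using MU.Fubini_integral[OF int] by simp
  also have "\<dots> \<le> (\<integral>x. p x * C \<partial>unif01)"
  proof (intro integral_mono)
    show "integrable unif01 (\<lambda>x. \<integral>\<omega>. p x * exp (l * f \<omega> x) \<partial>M)"
      using MU.integrable_snd[OF int] by simp
  qed (use ip C p0 in \<open>auto intro!: mult_left_mono\<close>)
  finally have EC: "expectation E \<le> C" by (simp add: p1)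
  have E0: "0 \<le> E \<omega>" for \<omega>
    using p0 by (auto simp: E_def intro!: integral_nonneg)
  have "prob {\<omega>\<in>space M. t < Q \<omega>} \<le> prob {\<omega>\<in>space M. exp (l * t) \<le> E \<omega>}"
    using l jensen by (intro finite_measure_mono) (auto intro!: order_trans[OF _ jensen] mult_left_mono)
  also have "\<dots> \<le> expectation E / exp (l * t)"
    using iE E0 by (intro integral_Markov_inequality_measure[where A="{}"]) auto
  also have "\<dots> \<le> C / exp (l * t)"
    using EC by (intro divide_right_mono) auto
  finally show ?thesis by (simp add: Q_def exp_minus divide_inverse mult.commute)
qed

end

section \<open>The empirical process\<close>

text \<open>The range condition holds at every point of the space, so that bounds and integral
  identities are available for each fixed \<omega>.\<close>

locale iid_unit_samples = prob_space M for M :: "'a measure" +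
  fixes X :: "nat \<Rightarrow> 'a \<Rightarrow> real"
  assumes indep: "indep_vars (\<lambda>_. borel) X UNIV"
    and identical: "distr M borel (X i) = distr M borel (X 0)"
    and unit_range: "\<omega> \<in> space M \<Longrightarrow> X i \<omega> \<in> {0..1}"
begin

lemma measurable_X [measurable]: "X i \<in> borel_measurable M"
  using indep by (auto simp: indep_vars_def)

lemma expectation_identical:
  fixes h :: "real \<Rightarrow> real"
  assumes [measurable]: "h \<in> borel_measurable borel"
  shows "expectation (\<lambda>\<omega>. h (X i \<omega>)) = expectation (\<lambda>\<omega>. h (X 0 \<omega>))"
proof -
  have "expectation (\<lambda>\<omega>. h (X i \<omega>)) = (\<integral>x. h x \<partial>distr M borel (X i))" for i
    by (simp add: integral_distr)
  then show ?thesis by (simp add: identical[of i])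
qed

lemma integrable_X_bounded:
  fixes h :: "real \<Rightarrow> real"
  assumes [measurable]: "h \<in> borel_measurable borel" and "\<And>y. y \<in> {0..1} \<Longrightarrow> \<bar>h y\<bar> \<le> B"
  shows "integrable M (\<lambda>\<omega>. h (X i \<omega>))"
  using assms(2) unit_range by (intro integrable_const_bound[where B=B] AE_I2) auto

section \<open>Normalised sums and their exponential moments\<close>

text \<open>No centring is built in: the functions h to which moment bounds are applied have mean 0
  themselves.\<close>

definition norm_sum :: "nat \<Rightarrow> (real \<Rightarrow> real) \<Rightarrow> 'a \<Rightarrow> real" where
  "norm_sum N h \<omega> = (\<Sum>i<N. h (X i \<omega>)) / sqrt (real N)"

lemma measurable_norm_sum [measurable]:
  assumes [measurable]: "h \<in> borel_measurable borel"
  shows "norm_sum N h \<in> borel_measurable M"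
  unfolding norm_sum_def[abs_def] by measurable

lemma norm_sum_diff: "norm_sum N (\<lambda>y. g y - h y) \<omega> = norm_sum N g \<omega> - norm_sum N h \<omega>"
  by (simp add: norm_sum_def sum_subtractf diff_divide_distrib)

lemma norm_sum_mult: "norm_sum N (\<lambda>y. c * h y) \<omega> = c * norm_sum N h \<omega>"
  by (simp add: norm_sum_def sum_distrib_left)

lemma abs_norm_sum_le:
  assumes "\<omega> \<in> space M" and B: "\<And>y. y \<in> {0..1} \<Longrightarrow> \<bar>h y\<bar> \<le> B"
  shows "\<bar>norm_sum N h \<omega>\<bar> \<le> sqrt (real N) * B"
proof -
  have "\<bar>\<Sum>i<N. h (X i \<omega>)\<bar> \<le> (\<Sum>i<N. \<bar>h (X i \<omega>)\<bar>)" by (rule sum_abs)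
  also have "\<dots> \<le> (\<Sum>i<N. B)" using assms unit_range by (intro sum_mono) auto
  also have "\<dots> = sqrt (real N) * sqrt (real N) * B" by simp
  finally show ?thesis
    by (cases "N = 0") (auto simp: norm_sum_def divide_simps mult_ac)
qed

text \<open>Independence gives the N-th power of a one-variable moment at
  \<open>t = l / sqrt N\<close>. Then N times the square of t is the square of l, while N times the
  cube is only of order 1 / sqrt N.\<close>

lemma expectation_exp_norm_sum_le:
  assumes [measurable]: "h \<in> borel_measurable borel" and B: "\<And>y. y \<in> {0..1} \<Longrightarrow> \<bar>h y\<bar> \<le> B"
    and m: "expectation (\<lambda>\<omega>. h (X 0 \<omega>)) = 0" and v: "expectation (\<lambda>\<omega>. (h (X 0 \<omega>))\<^sup>2) \<le> v"
    and N: "N > 0" "\<bar>l\<bar> * B \<le> sqrt (real N)"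
  shows "expectation (\<lambda>\<omega>. exp (l * norm_sum N h \<omega>)) \<le> exp (l\<^sup>2 * v / 2 + \<bar>l\<bar> ^ 3 * B ^ 3 / sqrt (real N))"
proof -
  define t where "t = l / sqrt (real N)"
  have t: "\<bar>t\<bar> * B \<le> 1" using N by (simp add: t_def divide_simps)
  have "expectation (\<lambda>\<omega>. exp (l * norm_sum N h \<omega>)) = expectation (\<lambda>\<omega>. \<Prod>i<N. exp (t * h (X i \<omega>)))"
    by (simp add: norm_sum_def t_def exp_sum[symmetric] sum_distrib_left sum_divide_distrib[symmetric])
  also have "\<dots> = (\<Prod>i<N. expectation (\<lambda>\<omega>. exp (t * h (X i \<omega>))))"
  proof (rule indep_vars_lebesgue_integral)
    show "indep_vars (\<lambda>_. borel) (\<lambda>i \<omega>. exp (t * h (X i \<omega>))) {..<N}"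
      by (rule indep_vars_compose2[OF indep_vars_subset[OF indep]]) auto
    show "integrable M (\<lambda>\<omega>. exp (t * h (X i \<omega>)))" for i
    proof (rule integrable_X_bounded[where h="\<lambda>y. exp (t * h y)" and B="exp 1"])
      show "\<bar>exp (t * h y)\<bar> \<le> exp 1" if "y \<in> {0..1}" for y
      proof -
        have "t * h y \<le> \<bar>t\<bar> * \<bar>h y\<bar>" by (metis abs_ge_self abs_mult)
        also have "\<dots> \<le> \<bar>t\<bar> * B" using B[OF that] by (intro mult_left_mono) auto
        finally show ?thesis using t by simp
      qed
    qed measurable
  qed simp
  also have "\<dots> = (\<Prod>i<N. expectation (\<lambda>\<omega>. exp (t * h (X 0 \<omega>))))"
    by (intro prod.cong refl expectation_identical[where h="\<lambda>y. exp (t * h y)"]) measurable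
  also have "\<dots> \<le> (\<Prod>i<N. exp (t\<^sup>2 * v / 2 + \<bar>t\<bar> ^ 3 * B ^ 3))"
    using B unit_range m v t
    by (intro prod_mono conjI expectation_exp_le) (auto intro!: integral_nonneg)
  also have "\<dots> = exp (real N * (t\<^sup>2 * v / 2 + \<bar>t\<bar> ^ 3 * B ^ 3))"
    by (simp add: exp_of_nat_mult)
  also have "real N * (t\<^sup>2 * v / 2 + \<bar>t\<bar> ^ 3 * B ^ 3) = l\<^sup>2 * v / 2 + \<bar>l\<bar> ^ 3 * B ^ 3 / sqrt (real N)"
  proof -
    have "real N * t\<^sup>2 = l\<^sup>2" using N by (simp add: t_def power_divide)
    moreover have "real N * \<bar>t\<bar> ^ 3 = \<bar>l\<bar> ^ 3 / sqrt (real N)"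
      using N by (simp add: t_def power_divide power3_eq_cube)
    moreover have "real N * (t\<^sup>2 * v / 2 + \<bar>t\<bar> ^ 3 * B ^ 3) = (real N * t\<^sup>2) * v / 2 + (real N * \<bar>t\<bar> ^ 3) * B ^ 3"
      by (simp add: distrib_left)
    ultimately show ?thesis by simp
  qed
  finally show ?thesis .
qed

lemma integrable_exp_norm_sum:
  assumes [measurable]: "h \<in> borel_measurable borel" and B: "\<And>y. y \<in> {0..1} \<Longrightarrow> \<bar>h y\<bar> \<le> B"
  shows "integrable M (\<lambda>\<omega>. exp (l * norm_sum N h \<omega>))"
proof (rule integrable_const_bound[where B="exp (\<bar>l\<bar> * (sqrt (real N) * B))"], rule AE_I2)
  fix \<omega> assume w: "\<omega> \<in> space M"
  have "l * norm_sum N h \<omega> \<le> \<bar>l\<bar> * \<bar>norm_sum N h \<omega>\<bar>" by (metis abs_ge_self abs_mult)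
  also have "\<dots> \<le> \<bar>l\<bar> * (sqrt (real N) * B)"
    using abs_norm_sum_le[OF w B] by (intro mult_left_mono) auto
  finally show "norm (exp (l * norm_sum N h \<omega>)) \<le> exp (\<bar>l\<bar> * (sqrt (real N) * B))" by simp
qed measurable

text \<open>Since \<open>exp (l * \<bar>a\<bar>) \<le> exp (l * a) + exp (- l * a)\<close>, the
  absolute value costs a factor 2.\<close>

lemma expectation_exp_abs_norm_sum_le:
  assumes [measurable]: "h \<in> borel_measurable borel" and B: "\<And>y. y \<in> {0..1} \<Longrightarrow> \<bar>h y\<bar> \<le> B"
    and m: "expectation (\<lambda>\<omega>. h (X 0 \<omega>)) = 0" and v: "expectation (\<lambda>\<omega>. (h (X 0 \<omega>))\<^sup>2) \<le> v"
    and N: "N > 0" "l * B \<le> sqrt (real N)" and l: "0 \<le> l"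
  shows "integrable M (\<lambda>\<omega>. exp (l * \<bar>norm_sum N h \<omega>\<bar>))" (is ?int)
    and "expectation (\<lambda>\<omega>. exp (l * \<bar>norm_sum N h \<omega>\<bar>)) \<le> 2 * exp (l\<^sup>2 * v / 2 + l ^ 3 * B ^ 3 / sqrt (real N))"
proof -
  let ?E = "exp (l\<^sup>2 * v / 2 + l ^ 3 * B ^ 3 / sqrt (real N))"
  note i = integrable_exp_norm_sum[OF assms(1) B, of _ N]
  have *: "exp (l * \<bar>a\<bar>) \<le> exp (l * a) + exp ((-l) * a)" for a
    by (cases "a \<ge> 0") auto
  show ?int
  proof (rule Bochner_Integration.integrable_bound[OF Bochner_Integration.integrable_add[OF i[of l] i[of "-l"]]])
    show "AE \<omega> in M. norm (exp (l * \<bar>norm_sum N h \<omega>\<bar>)) \<le> norm (exp (l * norm_sum N h \<omega>) + exp (- l * norm_sum N h \<omega>))"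
      using * by (intro AE_I2) (smt (verit) exp_ge_zero real_norm_def)
  qed measurable
  then have "expectation (\<lambda>\<omega>. exp (l * \<bar>norm_sum N h \<omega>\<bar>))
     \<le> expectation (\<lambda>\<omega>. exp (l * norm_sum N h \<omega>) + exp ((-l) * norm_sum N h \<omega>))"
    using i[of l] i[of "-l"] * by (intro integral_mono) auto
  also have "\<dots> = expectation (\<lambda>\<omega>. exp (l * norm_sum N h \<omega>)) + expectation (\<lambda>\<omega>. exp ((-l) * norm_sum N h \<omega>))"
    by (rule Bochner_Integration.integral_add[OF i i])
  also have "\<dots> \<le> ?E + ?E"
    using expectation_exp_norm_sum_le[OF assms(1) B m v N(1), of l]
      expectation_exp_norm_sum_le[OF assms(1) B m v N(1), of "-l"] N l
    by (intro add_mono) auto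
  finally show "expectation (\<lambda>\<omega>. exp (l * \<bar>norm_sum N h \<omega>\<bar>)) \<le> 2 * ?E" by simp
qed

section \<open>Centred indicators and their variances\<close>

definition F :: "real \<Rightarrow> real" where
  "F = cdf (distr M borel (X 0))"

definition step :: "real \<Rightarrow> real \<Rightarrow> real" where
  "step x y = (if y \<le> x then 1 else 0) - F x"

text \<open>The sign makes \<open>lin y\<close> the integral of \<open>step x y\<close> over x, so
  that \<open>norm_sum N lin\<close> is the integral of the empirical process.\<close>

definition lin :: "real \<Rightarrow> real" where
  "lin y = expectation (X 0) - y"

sublocale law: real_distribution "distr M borel (X 0)"
  by (rule real_distribution_distr) measurable

lemma F_bounds: "0 \<le> F x" "F x \<le> 1"
  by (simp_all add: F_def law.cdf_nonneg law.cdf_bounded_prob)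

lemma F_mono: "x \<le> y \<Longrightarrow> F x \<le> F y"
  by (simp add: F_def law.cdf_nondecreasing)

lemma measurable_F [measurable]: "F \<in> borel_measurable borel"
  by (rule borel_measurable_mono) (simp add: mono_def F_mono)

lemma F_eq: "F x = expectation (\<lambda>\<omega>. if X 0 \<omega> \<le> x then 1 else 0)"
proof -
  have "F x = expectation (\<lambda>\<omega>. indicat_real {..x} (X 0 \<omega>))"
    unfolding F_def by (rule cdf_eq_integral) (auto simp: prob_space_axioms)
  also have "\<dots> = expectation (\<lambda>\<omega>. if X 0 \<omega> \<le> x then 1 else 0)"
    by (intro Bochner_Integration.integral_cong) (auto simp: indicator_def)
  finally show ?thesis .
qed

lemma measurable_step [measurable (raw)]:
  assumes [measurable]: "f \<in> borel_measurable L" "g \<in> borel_measurable L"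
  shows "(\<lambda>z. step (f z) (g z)) \<in> borel_measurable L"
  unfolding step_def[abs_def] by measurable

lemma measurable_lin [measurable]: "lin \<in> borel_measurable borel"
  unfolding lin_def[abs_def] by measurable

lemma abs_step_le: "\<bar>step x y\<bar> \<le> 1"
  using F_bounds[of x] by (auto simp: step_def)

lemma integrable_X: "integrable M (X i)"
  using integrable_X_bounded[of "\<lambda>x. x" 1 i] by auto

lemma mean_bounds: "0 \<le> expectation (X 0)" "expectation (X 0) \<le> 1"
  using unit_range[of _ 0] integrable_X[of 0]
  by (auto intro!: integral_nonneg_AE integral_le_const)

lemma abs_lin_le: "y \<in> {0..1} \<Longrightarrow> \<bar>lin y\<bar> \<le> 1"
  using mean_bounds by (auto simp: lin_def)

lemma integrable_step: "integrable M (\<lambda>\<omega>. step x (X i \<omega>))"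
  by (rule integrable_X_bounded[where B=1]) (simp_all add: abs_step_le)

lemma integrable_ind: "integrable M (\<lambda>\<omega>. if X i \<omega> \<le> x then 1 else 0 :: real)"
  by (rule integrable_const_bound[where B=1]) auto

lemma expectation_step: "expectation (\<lambda>\<omega>. step x (X 0 \<omega>)) = 0"
  using integrable_ind[of 0 x] by (simp add: step_def F_eq[symmetric] prob_space)

lemma expectation_lin: "expectation (\<lambda>\<omega>. lin (X 0 \<omega>)) = 0"
  using integrable_X[of 0] by (simp add: lin_def prob_space)

text \<open>For y \<le> x the difference of the indicators is a Bernoulli variable with parameter d
  = F x - F y, of variance d (1 - d).\<close>

lemma variance_step_diff_le:
  "expectation (\<lambda>\<omega>. (step x (X 0 \<omega>) - step y (X 0 \<omega>))\<^sup>2) \<le> \<bar>F x - F y\<bar>"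
proof -
  have *: "expectation (\<lambda>\<omega>. (step x (X 0 \<omega>) - step y (X 0 \<omega>))\<^sup>2) \<le> F x - F y" if "y \<le> x" for x y
  proof -
    let ?i = "\<lambda>x \<omega>. if X 0 \<omega> \<le> x then 1 else 0 :: real"
    define d where "d = F x - F y"
    have "(step x (X 0 \<omega>) - step y (X 0 \<omega>))\<^sup>2 = (1 - 2 * d) * (?i x \<omega> - ?i y \<omega>) + d\<^sup>2" for \<omega>
      using that by (auto simp: step_def d_def power2_eq_square algebra_simps)
    then have "expectation (\<lambda>\<omega>. (step x (X 0 \<omega>) - step y (X 0 \<omega>))\<^sup>2) =
      expectation (\<lambda>\<omega>. (1 - 2 * d) * (?i x \<omega> - ?i y \<omega>) + d\<^sup>2)" by presburger
    also have "\<dots> = (1 - 2 * d) * (F x - F y) + d\<^sup>2"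
      using integrable_ind[of 0 x] integrable_ind[of 0 y] by (simp add: prob_space F_eq)
    also have "\<dots> = d - d\<^sup>2" by (simp add: d_def power2_eq_square algebra_simps)
    finally show ?thesis by (simp add: d_def)
  qed
  show ?thesis
  proof (cases "y \<le> x")
    case True then show ?thesis using *[of y x] F_mono[of y x] by simp
  next
    case False then show ?thesis using *[of x y] F_mono[of x y] by (simp add: power2_commute)
  qed
qed

lemma variance_step: "expectation (\<lambda>\<omega>. (step x (X 0 \<omega>))\<^sup>2) = F x * (1 - F x)"
proof -
  let ?i = "\<lambda>x \<omega>. if X 0 \<omega> \<le> x then 1 else 0 :: real"
  have "(step x (X 0 \<omega>))\<^sup>2 = (1 - 2 * F x) * ?i x \<omega> + (F x)\<^sup>2" for \<omega>
    by (auto simp: step_def power2_eq_square algebra_simps)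
  then have "expectation (\<lambda>\<omega>. (step x (X 0 \<omega>))\<^sup>2) = expectation (\<lambda>\<omega>. (1 - 2 * F x) * ?i x \<omega> + (F x)\<^sup>2)" by presburger
  also have "\<dots> = (1 - 2 * F x) * F x + (F x)\<^sup>2"
    using integrable_ind[of 0 x] by (simp add: prob_space F_eq)
  finally show ?thesis by (simp add: power2_eq_square algebra_simps)
qed

text \<open>Popoviciu's inequality: the variance is at most the second moment about c, and h stays
  within 1/2 of c.\<close>

lemma variance_le_quarter:
  fixes h :: "real \<Rightarrow> real"
  assumes [measurable]: "h \<in> borel_measurable borel" and c: "\<And>y. y \<in> {0..1} \<Longrightarrow> \<bar>h y - c\<bar> \<le> 1 / 2"
    and m: "expectation (\<lambda>\<omega>. h (X 0 \<omega>)) = 0"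
  shows "expectation (\<lambda>\<omega>. (h (X 0 \<omega>))\<^sup>2) \<le> 1 / 4"
proof -
  have b: "\<bar>h y\<bar> \<le> 1 / 2 + \<bar>c\<bar>" if "y \<in> {0..1}" for y using c[OF that] by linarith
  have i1: "integrable M (\<lambda>\<omega>. h (X 0 \<omega>))"
    by (rule integrable_X_bounded[OF _ b]) auto
  have i2: "integrable M (\<lambda>\<omega>. (h (X 0 \<omega>))\<^sup>2)"
    by (rule integrable_X_bounded[where h="\<lambda>y. (h y)\<^sup>2" and B="(1 / 2 + \<bar>c\<bar>)\<^sup>2"])
      (auto simp: abs_le_square_iff[symmetric] intro: order_trans[OF b])
  have sq: "(h y - c)\<^sup>2 \<le> 1 / 4" if "y \<in> {0..1}" for y
    using power_mono[OF c[OF that], of 2] by (simp add: power2_eq_square)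
  have "expectation (\<lambda>\<omega>. (h (X 0 \<omega>))\<^sup>2) \<le> expectation (\<lambda>\<omega>. 1 / 4 + 2 * c * h (X 0 \<omega>))"
  proof (intro integral_mono)
    fix \<omega> assume "\<omega> \<in> space M"
    then have "(h (X 0 \<omega>) - c)\<^sup>2 \<le> 1 / 4" by (intro sq unit_range)
    moreover have "(h (X 0 \<omega>) - c)\<^sup>2 = (h (X 0 \<omega>))\<^sup>2 - 2 * c * h (X 0 \<omega>) + c\<^sup>2"
      by (simp add: power2_diff)
    ultimately show "(h (X 0 \<omega>))\<^sup>2 \<le> 1 / 4 + 2 * c * h (X 0 \<omega>)"
      using zero_le_power2[of c] by linarith
  qed (use i1 i2 in auto)
  also have "\<dots> = 1 / 4" using i1 by (simp add: m prob_space)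
  finally show ?thesis .
qed

lemma variance_lin: "expectation (\<lambda>\<omega>. (lin (X 0 \<omega>))\<^sup>2) \<le> 1 / 4"
proof (rule variance_le_quarter[where c="expectation (X 0) - 1/2"])
  show "\<bar>lin y - (expectation (X 0) - 1/2)\<bar> \<le> 1/2" if "y \<in> {0..1}" for y
    using that unfolding lin_def atLeastAtMost_iff by linarith
qed (auto simp: expectation_lin)

text \<open>\<open>X + 1\<^bsub>X \<le> x\<^esub>\<close> takes its values in an interval of length 1.\<close>

lemma variance_lin_step_le_quarter:
  "expectation (\<lambda>\<omega>. (lin (X 0 \<omega>) - step x (X 0 \<omega>))\<^sup>2) \<le> 1 / 4"
proof (rule variance_le_quarter[where h="\<lambda>y. lin y - step x y" and c="expectation (X 0) + F x - clip x - 1/2"])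
  show "\<bar>lin y - step x y - (expectation (X 0) + F x - clip x - 1/2)\<bar> \<le> 1/2" if "y \<in> {0..1}" for y
    using that unfolding lin_def step_def atLeastAtMost_iff clip_def by (split if_split) linarith
  show "expectation (\<lambda>\<omega>. lin (X 0 \<omega>) - step x (X 0 \<omega>)) = 0"
    using integrable_step[of x 0] integrable_X[of 0] expectation_lin expectation_step
    by (subst Bochner_Integration.integral_diff) (auto simp: lin_def)
qed auto

section \<open>The empirical process and its integral\<close>

definition G :: "nat \<Rightarrow> real \<Rightarrow> 'a \<Rightarrow> real" where
  "G N x \<omega> = norm_sum N (step x) \<omega>"

lemma measurable_G [measurable]: "(\<lambda>(\<omega>, x). G N x \<omega>) \<in> borel_measurable (M \<Otimes>\<^sub>M borel)"
  unfolding G_def[abs_def] norm_sum_def[abs_def] by measurable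

lemma measurable_G_space:
  assumes "\<omega> \<in> space M"
  shows "(\<lambda>x. G N x \<omega>) \<in> borel_measurable borel"
  using measurable_Pair2[OF measurable_G assms] by simp

lemma abs_G_le: "\<omega> \<in> space M \<Longrightarrow> \<bar>G N x \<omega>\<bar> \<le> sqrt (real N)"
  using abs_norm_sum_le[of \<omega> "step x" 1 N] by (simp add: G_def abs_step_le)

lemma integrable_G: "\<omega> \<in> space M \<Longrightarrow> integrable unif01 (\<lambda>x. G N x \<omega>)"
  using abs_G_le measurable_G_space
  by (intro unif01.integrable_const_bound[where B="sqrt (real N)"] AE_I2) auto

lemma integral_ind_unif01:
  assumes "y \<in> {0..1}"
  shows "(\<integral>x. (if y \<le> x then 1 else 0) \<partial>unif01) = 1 - y"
proof -
  have "(\<integral>x. (if y \<le> x then 1 else 0) \<partial>unif01) = (\<integral>x. indicat_real {y..} x \<partial>unif01)"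
    by (intro Bochner_Integration.integral_cong) (auto simp: indicator_def)
  then show ?thesis by (simp only: integral_unif01_indicator_ge[OF assms])
qed

lemma integrable_ind_unif01: "integrable unif01 (\<lambda>x. if y \<le> x then 1 else 0 :: real)"
  by (rule unif01.integrable_const_bound[where B=1]) auto

lemma integrable_F: "integrable unif01 F"
  using F_bounds by (intro unif01.integrable_const_bound[where B=1]) auto

lemma integral_F: "(\<integral>x. F x \<partial>unif01) = 1 - expectation (X 0)"
proof -
  interpret MU: pair_prob_space M unif01 ..
  have "(\<lambda>(\<omega>, x). if X 0 \<omega> \<le> x then 1 else 0 :: real) \<in> borel_measurable (M \<Otimes>\<^sub>M borel)"
    by measurable
  then have "(\<lambda>(\<omega>, x). if X 0 \<omega> \<le> x then 1 else 0 :: real) \<in> borel_measurable (M \<Otimes>\<^sub>M unif01)"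
    by (simp cong: measurable_cong_sets sets_pair_measure_cong)
  then have int: "integrable (M \<Otimes>\<^sub>M unif01) (\<lambda>(\<omega>, x). if X 0 \<omega> \<le> x then 1 else 0 :: real)"
    by (intro MU.integrable_const_bound[where B=1]) auto
  have "(\<integral>x. F x \<partial>unif01) = (\<integral>\<omega>. (\<integral>x. (if X 0 \<omega> \<le> x then 1 else 0) \<partial>unif01) \<partial>M)"
    using MU.Fubini_integral[OF int] by (simp add: F_eq)
  also have "\<dots> = expectation (\<lambda>\<omega>. 1 - X 0 \<omega>)"
    by (intro Bochner_Integration.integral_cong refl integral_ind_unif01 unit_range)
  also have "\<dots> = 1 - expectation (X 0)"
    using integrable_X by (simp add: prob_space)
  finally show ?thesis .
qed

lemma integrable_step_unif01: "integrable unif01 (\<lambda>x. step x y)"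
  using integrable_ind_unif01 integrable_F by (simp add: step_def)

lemma integral_step: "y \<in> {0..1} \<Longrightarrow> (\<integral>x. step x y \<partial>unif01) = lin y"
  using integrable_ind_unif01 integrable_F
  by (simp add: step_def lin_def integral_F integral_ind_unif01)

lemma integral_G:
  assumes "\<omega> \<in> space M"
  shows "(\<integral>x. G N x \<omega> \<partial>unif01) = norm_sum N lin \<omega>"
  using unit_range[OF assms] integrable_step_unif01
  by (simp add: G_def norm_sum_def integral_step)

section \<open>Distance from the critical law\<close>

text \<open>The constant 1/2 is the distribution function on [0,1) of a fair coin on the endpoints 0
  and 1. The size of \<open>dev\<close> decides between the near and the far case.\<close>

definition dev :: real where
  "dev = (\<integral>x. \<bar>F x - 1/2\<bar> \<partial>unif01)"

lemma integrable_dev: "integrable unif01 (\<lambda>x. \<bar>F x - 1/2\<bar>)"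
  using integrable_F by auto

text \<open>As \<open>lin\<close> is the average of \<open>step y\<close> over y, convexity of the
  square bounds the left side by the average of the variances of \<open>step y - step x\<close>.
  Each is at most |F y - F x|, which is split at 1/2.\<close>

lemma variance_lin_step_le_dev:
  "expectation (\<lambda>\<omega>. (lin (X 0 \<omega>) - step x (X 0 \<omega>))\<^sup>2) \<le> dev + \<bar>F x - 1/2\<bar>"
proof -
  interpret MU: pair_prob_space M unif01 ..
  let ?f = "\<lambda>\<omega> y. (step y (X 0 \<omega>) - step x (X 0 \<omega>))\<^sup>2"
  have b: "\<bar>step y z - step x z\<bar> \<le> 2" for y z
    using abs_step_le[of y z] abs_step_le[of x z] by linarith
  have b2: "(step y z - step x z)\<^sup>2 \<le> 4" for y z
    using power_mono[OF b[of y z], of 2] by simp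
  have [measurable]: "(\<lambda>y. step y z) \<in> borel_measurable borel" for z by measurable
  have "(\<lambda>(\<omega>, y). ?f \<omega> y) \<in> borel_measurable (M \<Otimes>\<^sub>M borel)" by measurable
  then have "(\<lambda>(\<omega>, y). ?f \<omega> y) \<in> borel_measurable (M \<Otimes>\<^sub>M unif01)"
    by (simp cong: measurable_cong_sets sets_pair_measure_cong)
  then have int: "integrable (M \<Otimes>\<^sub>M unif01) (\<lambda>(\<omega>, y). ?f \<omega> y)"
    using b2 by (intro MU.integrable_const_bound[where B=4]) auto
  have "expectation (\<lambda>\<omega>. (lin (X 0 \<omega>) - step x (X 0 \<omega>))\<^sup>2) \<le> expectation (\<lambda>\<omega>. \<integral>y. ?f \<omega> y \<partial>unif01)"
  proof (rule integral_mono)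
    show "integrable M (\<lambda>\<omega>. (lin (X 0 \<omega>) - step x (X 0 \<omega>))\<^sup>2)"
    proof (rule integrable_X_bounded[where h="\<lambda>y. (lin y - step x y)\<^sup>2" and B=4])
      fix y :: real assume "y \<in> {0..1}"
      then have "\<bar>lin y - step x y\<bar> \<le> 2"
        using abs_lin_le[of y] abs_step_le[of x y] by linarith
      from power_mono[OF this, of 2] show "\<bar>(lin y - step x y)\<^sup>2\<bar> \<le> 4" by simp
    qed measurable
    show "integrable M (\<lambda>\<omega>. \<integral>y. ?f \<omega> y \<partial>unif01)"
      using MU.integrable_fst[OF int] by simp
    fix \<omega> assume w: "\<omega> \<in> space M"
    define a where "a = lin (X 0 \<omega>) - step x (X 0 \<omega>)"
    have ia: "(\<integral>y. step y (X 0 \<omega>) - step x (X 0 \<omega>) \<partial>unif01) = a"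
      using integrable_step_unif01 unit_range[OF w] by (simp add: a_def integral_step unif01.prob_space)
    \<comment> \<open>Jensen for the square, through its tangent at the mean a: the square of b is
      at least 2 a b minus the square of a.\<close>
    have "a\<^sup>2 = 2 * a * (\<integral>y. step y (X 0 \<omega>) - step x (X 0 \<omega>) \<partial>unif01) - a\<^sup>2"
      unfolding ia by (simp add: power2_eq_square)
    also have "\<dots> = (\<integral>y. 2 * a * (step y (X 0 \<omega>) - step x (X 0 \<omega>)) - a\<^sup>2 \<partial>unif01)"
      using integrable_step_unif01 by (simp add: unif01.prob_space)
    also have "\<dots> \<le> (\<integral>y. ?f \<omega> y \<partial>unif01)"
    proof (rule integral_mono)
      show "integrable unif01 (?f \<omega>)"
        using b2 by (intro unif01.integrable_const_bound[where B=4]) auto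
      fix y
      show "2 * a * (step y (X 0 \<omega>) - step x (X 0 \<omega>)) - a\<^sup>2 \<le> ?f \<omega> y"
        using zero_le_power2[of "step y (X 0 \<omega>) - step x (X 0 \<omega>) - a"]
        by (subst (asm) power2_diff) (simp add: mult_ac)
    qed (use integrable_step_unif01 in auto)
    finally show "(lin (X 0 \<omega>) - step x (X 0 \<omega>))\<^sup>2 \<le> (\<integral>y. ?f \<omega> y \<partial>unif01)"
      by (simp add: a_def)
  qed
  also have "\<dots> = (\<integral>y. expectation (\<lambda>\<omega>. ?f \<omega> y) \<partial>unif01)"
    using MU.Fubini_integral[OF int] by simp
  also have "\<dots> \<le> (\<integral>y. \<bar>F y - 1/2\<bar> + \<bar>F x - 1/2\<bar> \<partial>unif01)"
  proof (rule integral_mono)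
    show "integrable unif01 (\<lambda>y. expectation (\<lambda>\<omega>. ?f \<omega> y))"
      using MU.integrable_snd[OF int] by simp
    fix y
    have "expectation (\<lambda>\<omega>. ?f \<omega> y) \<le> \<bar>F y - F x\<bar>" by (rule variance_step_diff_le)
    then show "expectation (\<lambda>\<omega>. ?f \<omega> y) \<le> \<bar>F y - 1/2\<bar> + \<bar>F x - 1/2\<bar>" by linarith
  qed (use integrable_dev in auto)
  also have "\<dots> = dev + \<bar>F x - 1/2\<bar>"
    using integrable_dev by (simp add: dev_def unif01.prob_space)
  finally show ?thesis .
qed

end

section \<open>Exponential tail bounds\<close>

lemma eventually_sqrt_ge: "\<forall>\<^sub>F N in sequentially. N > 0 \<and> b \<le> sqrt (real N)"
proof -
  have "filterlim (\<lambda>N. sqrt (real N)) at_top sequentially"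
    by (rule filterlim_compose[OF sqrt_at_top filterlim_real_sequentially])
  then have "\<forall>\<^sub>F N in sequentially. b \<le> sqrt (real N)"
    by (simp add: filterlim_at_top)
  then show ?thesis
    using eventually_gt_at_top[of 0] by eventually_elim auto
qed

text \<open>The linear part of the expansion at d = 0; after clearing denominators the slack is the
  square of d times 12 - 16 d, which is nonnegative. It converts the mean square deviation of F from
  1/2 into a gain in the exponent.\<close>

lemma inverse_square_half_minus_ge:
  fixes d :: real
  assumes "0 \<le> d" "d < 1/2"
  shows "4 * (1 + 4 * d) \<le> 1 / (1/2 - d)\<^sup>2"
proof -
  have "(1 - 2 * d)\<^sup>2 * (1 + 4 * d) = 1 - d\<^sup>2 * (12 - 16 * d)"
    by (simp add: power2_eq_square algebra_simps)
  also have "\<dots> \<le> 1" using assms by simp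
  finally have "4 * (1 + 4 * d) * (1/2 - d)\<^sup>2 \<le> 1"
    by (simp add: power2_eq_square algebra_simps)
  moreover have "0 < (1/2 - d)\<^sup>2" using assms by simp
  ultimately show ?thesis by (simp only: pos_le_divide_eq)
qed

context iid_unit_samples
begin

text \<open>
  If \<open>F\<close> is far from \<open>1/2\<close>, averaging against the weight \<open>w = 1/4 + F (1 - F)\<close>, an upper bound for
  the standard deviation of \<open>G N x\<close>, gains a factor in the exponent.
\<close>

lemma prob_integral_abs_gt_far:
  assumes k: "0 < k" and t: "0 \<le> \<tau>" "\<tau> \<le> dev"
  shows "\<exists>c. \<forall>\<^sub>F N in sequentially. prob {\<omega>\<in>space M. k < (\<integral>x. \<bar>G N x \<omega>\<bar> \<partial>unif01)}
    \<le> 2 * exp (- (2 * k\<^sup>2 * (1 + 4 * \<tau>\<^sup>2)) + c / sqrt (real N))"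
proof -
  define w where "w x = 1/4 + F x * (1 - F x)" for x
  define D where "D = (\<integral>x. \<bar>F x - 1/2\<bar>\<^sup>2 \<partial>unif01)"
  define S where "S = (\<integral>x. w x \<partial>unif01)"
  \<comment> \<open>The minimiser of \<open>- l * k + l\<^sup>2 * S\<^sup>2 / 2\<close>.\<close>
  define l where "l = k / S\<^sup>2"
  have [measurable]: "w \<in> borel_measurable borel" unfolding w_def[abs_def] by measurable
  have F2: "\<bar>F x - 1/2\<bar> \<le> 1/2" for x using F_bounds[of x] by linarith
  have F4: "\<bar>F x - 1/2\<bar>\<^sup>2 \<le> 1/4" for x
    using power_mono[OF F2[of x], of 2] by (simp add: power2_eq_square)
  \<comment> \<open>In this form the mean of w is 1/2 minus the mean square deviation of F from 1/2,
    which a square root of F (1 - F) would not give.\<close>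
  have w_eq: "w x = 1/2 - \<bar>F x - 1/2\<bar>\<^sup>2" for x
    by (simp add: w_def power2_eq_square algebra_simps)
  have w_bounds: "1/4 \<le> w x" "w x \<le> 1/2" for x
    using F4[of x] by (auto simp: w_eq)
  have iD: "integrable unif01 (\<lambda>x. \<bar>F x - 1/2\<bar>\<^sup>2)"
    using F4 by (intro unif01.integrable_const_bound[where B="1/4"] AE_I2) auto
  have iw: "integrable unif01 w"
    using w_bounds by (intro unif01.integrable_const_bound[where B="1/2"] AE_I2) (auto simp: order_trans[OF _ w_bounds(1)] abs_of_nonneg)
  have S_eq: "S = 1/2 - D"
    using iD by (simp add: S_def D_def w_eq unif01.prob_space)
  have S_bounds: "1/4 \<le> S" "S \<le> 1/2"
    unfolding S_def using w_bounds
    by (blast intro: unif01.integral_ge_const[OF iw] unif01.integral_le_const[OF iw] AE_I2)+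
  \<comment> \<open>Cauchy-Schwarz: the variance of |F - 1/2| under the uniform law is
    nonnegative.\<close>
  have "0 \<le> (\<integral>x. (\<bar>F x - 1/2\<bar> - dev)\<^sup>2 \<partial>unif01)" by simp
  also have "\<dots> = (\<integral>x. \<bar>F x - 1/2\<bar>\<^sup>2 - 2 * dev * \<bar>F x - 1/2\<bar> + dev\<^sup>2 \<partial>unif01)"
    by (intro Bochner_Integration.integral_cong) (auto simp: power2_diff)
  also have "\<dots> = D - 2 * dev * dev + dev\<^sup>2"
    using iD integrable_dev by (simp add: D_def dev_def unif01.prob_space)
  finally have "dev\<^sup>2 \<le> D" by (simp add: power2_eq_square)
  moreover have "\<tau>\<^sup>2 \<le> dev\<^sup>2" using t by (intro power_mono) auto
  ultimately have D: "\<tau>\<^sup>2 \<le> D" by linarith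
  have "4 * (1 + 4 * D) \<le> 1 / S\<^sup>2"
    unfolding S_eq using S_bounds by (intro inverse_square_half_minus_ge) (auto simp: S_eq D_def)
  moreover have "4 * (1 + 4 * \<tau>\<^sup>2) \<le> 4 * (1 + 4 * D)" using D by simp
  ultimately have S2: "4 * (1 + 4 * \<tau>\<^sup>2) \<le> 1 / S\<^sup>2" by (rule order_trans[rotated])
  have l0: "0 \<le> l" using k by (simp add: l_def)
  have bound: "prob {\<omega>\<in>space M. k < (\<integral>x. \<bar>G N x \<omega>\<bar> \<partial>unif01)}
    \<le> 2 * exp (- (2 * k\<^sup>2 * (1 + 4 * \<tau>\<^sup>2)) + (l ^ 3 * 2 ^ 3) / sqrt (real N))"
    if N: "N > 0" "l * 2 \<le> sqrt (real N)" for N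
  proof -
    \<comment> \<open>Rescaled so that the density \<open>w / S\<close> turns the average into the
      integral of |G|, while the variance at each x is at most the square of S, independently of
      x.\<close>
    let ?f = "\<lambda>\<omega> x. \<bar>G N x \<omega>\<bar> * (S / w x)"
    have f_eq: "?f \<omega> x = \<bar>norm_sum N (\<lambda>y. S / w x * step x y) \<omega>\<bar>" for \<omega> x
      unfolding norm_sum_mult G_def abs_mult using w_bounds[of x] S_bounds by simp
    have Sw: "0 \<le> S / w x" "S / w x \<le> 2" for x
      using w_bounds[of x] S_bounds by (auto simp: divide_simps)
    have "prob {\<omega>\<in>space M. k < (\<integral>x. w x / S * ?f \<omega> x \<partial>unif01)}
      \<le> exp (- l * k) * (2 * exp (l\<^sup>2 * S\<^sup>2 / 2 + l ^ 3 * 2 ^ 3 / sqrt (real N)))"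
    proof (rule prob_weighted_average_gt_le[where R="sqrt (real N) * 2" and c=2])
      show "\<bar>?f \<omega> x\<bar> \<le> sqrt (real N) * 2" if "\<omega> \<in> space M" for \<omega> x
        unfolding abs_mult using Sw[of x] abs_G_le[OF that, of N x] by (intro mult_mono) auto
      show "0 \<le> w x / S" "w x / S \<le> 2" for x
        using w_bounds[of x] S_bounds by (auto simp: divide_simps)
      show "(\<integral>x. w x / S \<partial>unif01) = 1"
        using S_bounds by (simp add: S_def[symmetric])
      show "expectation (\<lambda>\<omega>. exp (l * ?f \<omega> x)) \<le> 2 * exp (l\<^sup>2 * S\<^sup>2 / 2 + l ^ 3 * 2 ^ 3 / sqrt (real N))" for x
        unfolding f_eq
      proof (rule expectation_exp_abs_norm_sum_le(2))
        show "\<bar>S / w x * step x y\<bar> \<le> 2" for y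
          unfolding abs_mult using Sw[of x] mult_mono[of "\<bar>S / w x\<bar>" 2 "\<bar>step x y\<bar>" 1] abs_step_le[of x y] by auto
        show "expectation (\<lambda>\<omega>. S / w x * step x (X 0 \<omega>)) = 0"
          by (simp add: expectation_step)
        \<comment> \<open>With v = F (1 - F) the difference of the two sides is the square of v -
          1/4.\<close>
        have "F x * (1 - F x) \<le> (w x)\<^sup>2"
          using zero_le_power2[of "F x * (1 - F x) - 1/4"]
          by (simp add: w_def power2_sum power2_diff)
        then have "(S / w x)\<^sup>2 * (F x * (1 - F x)) \<le> (S / w x)\<^sup>2 * (w x)\<^sup>2"
          by (intro mult_left_mono) auto
        also have "\<dots> = S\<^sup>2" using w_bounds[of x] by (simp add: power_divide)
        finally show "expectation (\<lambda>\<omega>. (S / w x * step x (X 0 \<omega>))\<^sup>2) \<le> S\<^sup>2"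
          by (simp only: power_mult_distrib integral_mult_right_zero variance_step)
      qed (use N l0 in auto)
    qed (use l0 in measurable)
    also have "(\<lambda>\<omega>. \<integral>x. w x / S * ?f \<omega> x \<partial>unif01) = (\<lambda>\<omega>. \<integral>x. \<bar>G N x \<omega>\<bar> \<partial>unif01)"
    proof
      fix \<omega>
      have "w x / S * ?f \<omega> x = \<bar>G N x \<omega>\<bar>" for x
        using w_bounds[of x] S_bounds by (simp add: field_simps)
      then show "(\<integral>x. w x / S * ?f \<omega> x \<partial>unif01) = (\<integral>x. \<bar>G N x \<omega>\<bar> \<partial>unif01)" by presburger
    qed
    also have "exp (- l * k) * (2 * exp (l\<^sup>2 * S\<^sup>2 / 2 + l ^ 3 * 2 ^ 3 / sqrt (real N)))
      = 2 * exp (- (k\<^sup>2 / 2 * (1 / S\<^sup>2)) + l ^ 3 * 2 ^ 3 / sqrt (real N))"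
    proof -
      have "- l * k + l\<^sup>2 * S\<^sup>2 / 2 = - (k\<^sup>2 / 2 * (1 / S\<^sup>2))"
        using S_bounds by (simp add: l_def field_simps power2_eq_square)
      then show ?thesis by (simp flip: exp_add)
    qed
    also have "\<dots> \<le> 2 * exp (- (2 * k\<^sup>2 * (1 + 4 * \<tau>\<^sup>2)) + (l ^ 3 * 2 ^ 3) / sqrt (real N))"
    proof -
      have "k\<^sup>2 / 2 * (4 * (1 + 4 * \<tau>\<^sup>2)) \<le> k\<^sup>2 / 2 * (1 / S\<^sup>2)"
        by (rule mult_left_mono[OF S2]) simp
      then have "- (k\<^sup>2 / 2 * (1 / S\<^sup>2)) + (l ^ 3 * 2 ^ 3) / sqrt (real N)
        \<le> - (2 * k\<^sup>2 * (1 + 4 * \<tau>\<^sup>2)) + (l ^ 3 * 2 ^ 3) / sqrt (real N)"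
        by linarith
      from exp_le_cancel_iff[THEN iffD2, OF this] show ?thesis by linarith
    qed
    finally show ?thesis .
  qed
  have "\<forall>\<^sub>F N in sequentially. prob {\<omega>\<in>space M. k < (\<integral>x. \<bar>G N x \<omega>\<bar> \<partial>unif01)}
    \<le> 2 * exp (- (2 * k\<^sup>2 * (1 + 4 * \<tau>\<^sup>2)) + (l ^ 3 * 2 ^ 3) / sqrt (real N))"
    using eventually_sqrt_ge[of "l * 2"] by eventually_elim (use bound in auto)
  then show ?thesis by blast
qed

text \<open>
  If \<open>F\<close> is close to \<open>1/2\<close>, the part of \<open>G\<close> with the sign opposite to \<open>\<integral> G\<close> is penalised: where the
  signs of \<open>I = \<integral> G\<close> and \<open>G N x\<close> differ, \<open>\<bar>I\<bar> + \<bar>G N x\<bar> = \<bar>I - G N x\<bar>\<close>, and this has standard deviation at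
  most \<open>w x \<le> 1/2\<close>.
\<close>

lemma prob_integral_abs_gt_near:
  assumes k: "0 < \<eta>" "\<eta> < k" and t: "0 < \<tau>" "dev \<le> \<tau>" and K: "1 \<le> K" "K \<le> 1 / (4 * sqrt (2 * \<tau>))"
  shows "\<exists>c. \<forall>\<^sub>F N in sequentially.
    prob {\<omega>\<in>space M. k < (\<integral>x. \<bar>G N x \<omega>\<bar> \<partial>unif01) \<and> \<bar>norm_sum N lin \<omega>\<bar> \<le> k - \<eta>}
    \<le> 4 * exp (- (2 * (k + (K - 1) * \<eta>)\<^sup>2) + c / sqrt (real N))"
proof -
  \<comment> \<open>The square of w is the smaller of two bounds for the variance of
    \<open>lin - step x\<close>: 1/4, and \<open>dev + \<bar>F x - 1/2\<bar>\<close> with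
    \<open>dev\<close> replaced by \<tau>. As \<tau> is positive, w stays away from 0.\<close>
  define w where "w x = min (1/2) (sqrt (\<tau> + \<bar>F x - 1/2\<bar>))" for x
  define w0 where "w0 = min (1/2) (sqrt \<tau>)"
  define W where "W = (\<integral>x. w x \<partial>unif01)"
  define s where "s = k + (K - 1) * \<eta>"
  \<comment> \<open>The minimiser of \<open>- l * s + l\<^sup>2 / 8\<close>, for variance
    1/4.\<close>
  define l where "l = 4 * s"
  \<comment> \<open>A common bound for \<open>lin\<close> and for
    \<open>(lin - step x) / (2 * w x)\<close>, whose numerator is at most 2 in absolute
    value.\<close>
  define B where "B = 1 / w0"
  have [measurable]: "w \<in> borel_measurable borel" unfolding w_def[abs_def] by measurable
  have w0: "0 < w0" using t by (auto simp: w0_def)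
  have w_bounds: "w0 \<le> w x" "w x \<le> 1/2" for x
    by (auto simp: w_def w0_def min_le_iff_disj)
  have wpos: "0 < w x" for x using w_bounds(1)[of x] w0 by linarith
  have iw: "integrable unif01 w"
    using w_bounds wpos by (intro unif01.integrable_const_bound[where B="1/2"] AE_I2) (auto simp: less_imp_le)
  have W0: "w0 \<le> W" unfolding W_def using w_bounds iw by (auto intro!: unif01.integral_ge_const)
  have Wpos: "0 < W" using W0 w0 by linarith
  \<comment> \<open>Jensen for the square root, through its tangent at 2 \<tau>: the mean of \<tau>
    + |F - 1/2| is at most 2 \<tau>.\<close>
  have W: "W \<le> sqrt (2 * \<tau>)"
  proof -
    define r where "r = sqrt (2 * \<tau>)"
    have r: "0 < r" "r\<^sup>2 = 2 * \<tau>" using t by (auto simp: r_def)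
    have "W \<le> (\<integral>x. (\<tau> + \<bar>F x - 1/2\<bar>) / (2 * r) + r / 2 \<partial>unif01)"
      unfolding W_def
    proof (rule integral_mono)
      fix x
      define q where "q = \<tau> + \<bar>F x - 1/2\<bar>"
      have q: "0 \<le> q" using t by (simp add: q_def)
      have "sqrt q * (2 * r) \<le> q + r\<^sup>2"
        using zero_le_power2[of "sqrt q - r"] q by (simp add: power2_diff)
      then have "sqrt q \<le> (q + r\<^sup>2) / (2 * r)" using r by (simp add: pos_le_divide_eq)
      also have "\<dots> = q / (2 * r) + r / 2" using r by (simp add: field_simps power2_eq_square)
      finally show "w x \<le> (\<tau> + \<bar>F x - 1/2\<bar>) / (2 * r) + r / 2" by (simp add: w_def q_def min_le_iff_disj)
    qed (use iw integrable_dev in auto)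
    also have "\<dots> = (\<tau> + dev) / (2 * r) + r / 2"
      using integrable_dev by (simp add: dev_def unif01.prob_space)
    also have "\<dots> \<le> (2 * \<tau>) / (2 * r) + r / 2"
      using t r by (intro add_mono divide_right_mono) auto
    also have "\<dots> = r" using r by (simp add: field_simps power2_eq_square)
    finally show ?thesis by (simp add: r_def)
  qed
  have KW: "K \<le> 1 / (4 * W)"
    using W Wpos t by (intro order_trans[OF K(2)] divide_left_mono) auto
  have s0: "0 < s" using k K by (simp add: s_def add_pos_nonneg)
  have l0: "0 \<le> l" using s0 by (simp add: l_def)
  have "w0 \<le> 1/2" by (simp add: w0_def)
  then have B1: "2 \<le> B" using w0 divide_left_mono[of w0 "1/2" 1] by (simp add: B_def)
  have wB: "1 / w x \<le> B" for x
    unfolding B_def using w_bounds(1)[of x] w0 by (intro divide_left_mono) auto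
  have bound: "prob {\<omega>\<in>space M. k < (\<integral>x. \<bar>G N x \<omega>\<bar> \<partial>unif01) \<and> \<bar>norm_sum N lin \<omega>\<bar> \<le> k - \<eta>}
    \<le> 4 * exp (- (2 * s\<^sup>2) + (l ^ 3 * B ^ 3) / sqrt (real N))"
    if N: "N > 0" "l * B \<le> sqrt (real N)" for N
  proof -
    define I where "I \<omega> = norm_sum N lin \<omega>" for \<omega>
    \<comment> \<open>The normalisation by \<open>2 * w x\<close> brings the variance down to at
      most 1/4, the bound that also holds for I.\<close>
    define J where "J x \<omega> = norm_sum N (\<lambda>y. 1 / (2 * w x) * (lin y - step x y)) \<omega>" for x \<omega>
    have [measurable]: "I \<in> borel_measurable M" "\<And>x. J x \<in> borel_measurable M"
      unfolding I_def[abs_def] J_def[abs_def] by measurable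
    have J_eq: "J x \<omega> = (I \<omega> - G N x \<omega>) / (2 * w x)" for x \<omega>
      unfolding J_def norm_sum_mult norm_sum_diff I_def G_def by simp
    \<comment> \<open>The maximum allows I to be used where the signs agree and J where they differ;
      its exponential moment is at most the sum of the two.\<close>
    define f where "f \<omega> x = max \<bar>I \<omega>\<bar> \<bar>J x \<omega>\<bar>" for \<omega> x
    have f_meas: "(\<lambda>(\<omega>, x). f \<omega> x) \<in> borel_measurable (M \<Otimes>\<^sub>M borel)"
      unfolding f_def J_eq by measurable
    let ?E = "exp (l\<^sup>2 * (1/4) / 2 + l ^ 3 * B ^ 3 / sqrt (real N))"
    have linB: "\<bar>lin y\<bar> \<le> B" if "y \<in> {0..1}" for y
      using abs_lin_le[OF that] B1 by linarith
    have JB: "\<bar>1 / (2 * w x) * (lin y - step x y)\<bar> \<le> B" if "y \<in> {0..1}" for x y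
    proof -
      have "\<bar>lin y - step x y\<bar> \<le> 2" using abs_lin_le[OF that] abs_step_le[of x y] by linarith
      then have "\<bar>1 / (2 * w x) * (lin y - step x y)\<bar> \<le> 1 / (2 * w x) * 2"
        unfolding abs_mult using wpos[of x] by (intro mult_mono) auto
      also have "\<dots> = 1 / w x" by simp
      also have "\<dots> \<le> B" by (rule wB)
      finally show ?thesis .
    qed
    have Imgf: "integrable M (\<lambda>\<omega>. exp (l * \<bar>I \<omega>\<bar>))" "expectation (\<lambda>\<omega>. exp (l * \<bar>I \<omega>\<bar>)) \<le> 2 * ?E"
      unfolding I_def
      using expectation_exp_abs_norm_sum_le[OF measurable_lin linB expectation_lin variance_lin N l0] by blast+
    have Jvar: "expectation (\<lambda>\<omega>. (1 / (2 * w x) * (lin (X 0 \<omega>) - step x (X 0 \<omega>)))\<^sup>2) \<le> 1/4" for x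
    proof -
      define V where "V = expectation (\<lambda>\<omega>. (lin (X 0 \<omega>) - step x (X 0 \<omega>))\<^sup>2)"
      have "V \<le> 1/4" unfolding V_def by (rule variance_lin_step_le_quarter)
      moreover have "V \<le> \<tau> + \<bar>F x - 1/2\<bar>"
        using variance_lin_step_le_dev[of x] t(2) by (simp add: V_def)
      ultimately have "V \<le> (w x)\<^sup>2"
        using t by (auto simp: w_def min_def power2_eq_square)
      then have "(1 / (2 * w x))\<^sup>2 * V \<le> (1 / (2 * w x))\<^sup>2 * (w x)\<^sup>2"
        by (intro mult_left_mono) auto
      also have "\<dots> = 1/4" using wpos[of x] by (simp add: power2_eq_square)
      finally show ?thesis unfolding V_def by (simp only: power_mult_distrib integral_mult_right_zero)
    qed
    have Jmean: "expectation (\<lambda>\<omega>. 1 / (2 * w x) * (lin (X 0 \<omega>) - step x (X 0 \<omega>))) = 0" for x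
    proof -
      have "integrable M (\<lambda>\<omega>. lin (X 0 \<omega>))" using integrable_X by (simp add: lin_def)
      then show ?thesis
        using integrable_step[of x 0] by (simp add: expectation_lin expectation_step)
    qed
    have Jmgf: "integrable M (\<lambda>\<omega>. exp (l * \<bar>J x \<omega>\<bar>))" "expectation (\<lambda>\<omega>. exp (l * \<bar>J x \<omega>\<bar>)) \<le> 2 * ?E" for x
    proof -
      have "(\<lambda>y. 1 / (2 * w x) * (lin y - step x y)) \<in> borel_measurable borel" by measurable
      from expectation_exp_abs_norm_sum_le[OF this JB[of _ x] Jmean[of x] Jvar[of x] N l0]
      show "integrable M (\<lambda>\<omega>. exp (l * \<bar>J x \<omega>\<bar>))" "expectation (\<lambda>\<omega>. exp (l * \<bar>J x \<omega>\<bar>)) \<le> 2 * ?E"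
        unfolding J_def by blast+
    qed
    have fmgf: "expectation (\<lambda>\<omega>. exp (l * f \<omega> x)) \<le> 4 * ?E" for x
    proof -
      have le: "exp (l * f \<omega> x) \<le> exp (l * \<bar>I \<omega>\<bar>) + exp (l * \<bar>J x \<omega>\<bar>)" for \<omega>
        by (auto simp: f_def max_def)
      have "expectation (\<lambda>\<omega>. exp (l * f \<omega> x)) \<le> expectation (\<lambda>\<omega>. exp (l * \<bar>I \<omega>\<bar>) + exp (l * \<bar>J x \<omega>\<bar>))"
      proof (rule integral_mono)
        show "integrable M (\<lambda>\<omega>. exp (l * f \<omega> x))"
          by (rule Bochner_Integration.integrable_bound[OF Bochner_Integration.integrable_add[OF Imgf(1) Jmgf(1)[of x]]])
            (use le in \<open>auto simp: f_def intro: order_trans[OF _ abs_ge_self]\<close>)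
      qed (use le Imgf Jmgf in auto)
      also have "\<dots> = expectation (\<lambda>\<omega>. exp (l * \<bar>I \<omega>\<bar>)) + expectation (\<lambda>\<omega>. exp (l * \<bar>J x \<omega>\<bar>))"
        using Imgf Jmgf by simp
      also have "\<dots> \<le> 2 * ?E + 2 * ?E" using Imgf(2) Jmgf(2)[of x] by (intro add_mono)
      finally show ?thesis by simp
    qed
    have key: "s < (\<integral>x. w x / W * f \<omega> x \<partial>unif01)"
      if w: "\<omega> \<in> space M" and big: "k < (\<integral>x. \<bar>G N x \<omega>\<bar> \<partial>unif01)" and small: "\<bar>I \<omega>\<bar> \<le> k - \<eta>" for \<omega>
    proof -
      define A where "A = (\<integral>x. \<bar>G N x \<omega>\<bar> \<partial>unif01)"
      define \<sigma> where "\<sigma> = (if 0 \<le> I \<omega> then 1 else -1 :: real)"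
      have \<sigma>: "\<sigma> * I \<omega> = \<bar>I \<omega>\<bar>" by (simp add: \<sigma>_def)
      have iG: "integrable unif01 (\<lambda>x. G N x \<omega>)" by (rule integrable_G[OF w])
      \<comment> \<open>The function \<open>\<bar>G\<bar> - \<sigma> * G\<close> vanishes where G
        has the sign of I and equals 2 |G| elsewhere; its integral is A - |I|. The weight w
        integrates to W.\<close>
      have "\<bar>I \<omega>\<bar> + (A - \<bar>I \<omega>\<bar>) / (4 * W) = (\<integral>x. \<bar>I \<omega>\<bar> / W * w x + (\<bar>G N x \<omega>\<bar> - \<sigma> * G N x \<omega>) / (4 * W) \<partial>unif01)"
        using iw iG Wpos by (simp add: W_def[symmetric] A_def integral_G[OF w] I_def[symmetric] \<sigma> diff_divide_distrib)
      also have "\<dots> \<le> (\<integral>x. w x / W * f \<omega> x \<partial>unif01)"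
      proof (rule integral_mono)
        have fR: "\<bar>f \<omega> x\<bar> \<le> sqrt (real N) * B" for x
          using abs_norm_sum_le[OF w linB, where N=N] abs_norm_sum_le[OF w JB, where N=N] by (simp add: f_def I_def J_def)
        have "(\<lambda>x. f \<omega> x) \<in> borel_measurable borel"
          using measurable_Pair2[OF f_meas w] by simp
        moreover have "\<bar>w x / W * f \<omega> x\<bar> \<le> (1/2) / W * (sqrt (real N) * B)" for x
          unfolding abs_mult using fR[of x] wpos[of x] Wpos divide_right_mono[OF w_bounds(2)[of x], of W]
          by (intro mult_mono) auto
        ultimately show "integrable unif01 (\<lambda>x. w x / W * f \<omega> x)"
          by (intro unif01.integrable_const_bound[where B="(1/2) / W * (sqrt (real N) * B)"] AE_I2) auto
        fix x
        have "\<bar>I \<omega>\<bar> * w x + (\<bar>G N x \<omega>\<bar> - \<sigma> * G N x \<omega>) / 4 \<le> w x * f \<omega> x"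
        proof (cases "\<sigma> * G N x \<omega> \<ge> 0")
          case True
          then have "\<bar>G N x \<omega>\<bar> = \<sigma> * G N x \<omega>" by (auto simp: \<sigma>_def split: if_splits)
          then show ?thesis using wpos[of x] by (simp add: f_def mult.commute)
        next
          case False
          then have opp: "\<bar>I \<omega> - G N x \<omega>\<bar> = \<bar>I \<omega>\<bar> + \<bar>G N x \<omega>\<bar>" "\<bar>G N x \<omega>\<bar> = - \<sigma> * G N x \<omega>"
            by (auto simp: \<sigma>_def split: if_splits)
          have "\<bar>I \<omega>\<bar> * w x + (\<bar>G N x \<omega>\<bar> - \<sigma> * G N x \<omega>) / 4 = \<bar>I \<omega>\<bar> * w x + \<bar>G N x \<omega>\<bar> / 2"
            using opp by simp
          \<comment> \<open>Raising the weight of |I| from w to 1/2 produces half of |I| + |G| = |I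
            - G|, which is w |J|.\<close>
          also have "\<dots> \<le> \<bar>I \<omega>\<bar> * (1/2) + \<bar>G N x \<omega>\<bar> / 2"
            using w_bounds(2)[of x] by (intro add_mono mult_left_mono) auto
          also have "\<dots> = w x * \<bar>J x \<omega>\<bar>"
            using wpos[of x] opp(1) by (simp add: J_eq)
          also have "\<dots> \<le> w x * f \<omega> x" using wpos[of x] by (simp add: f_def)
          finally show ?thesis .
        qed
        then have "(\<bar>I \<omega>\<bar> * w x + (\<bar>G N x \<omega>\<bar> - \<sigma> * G N x \<omega>) / 4) / W \<le> w x * f \<omega> x / W"
          using Wpos by (intro divide_right_mono) auto
        then show "\<bar>I \<omega>\<bar> / W * w x + (\<bar>G N x \<omega>\<bar> - \<sigma> * G N x \<omega>) / (4 * W) \<le> w x / W * f \<omega> x"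
          by (simp add: add_divide_distrib)
      qed (use iw iG in auto)
      finally have 1: "\<bar>I \<omega>\<bar> + (A - \<bar>I \<omega>\<bar>) / (4 * W) \<le> (\<integral>x. w x / W * f \<omega> x \<partial>unif01)" .
      have gap: "\<eta> < A - \<bar>I \<omega>\<bar>" using big small by (simp add: A_def)
      \<comment> \<open>The lower bound is at least |I| + K (A - |I|) = A + (K - 1) (A - |I|). Here
        A exceeds k and A - |I| exceeds \<eta>, which is how s arises.\<close>
      have "K * (A - \<bar>I \<omega>\<bar>) \<le> 1 / (4 * W) * (A - \<bar>I \<omega>\<bar>)"
        using KW gap k by (intro mult_right_mono) auto
      moreover have "(K - 1) * \<eta> \<le> (K - 1) * (A - \<bar>I \<omega>\<bar>)"
        using K gap by (intro mult_left_mono) auto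
      ultimately have "s < \<bar>I \<omega>\<bar> + 1 / (4 * W) * (A - \<bar>I \<omega>\<bar>)"
        using big by (simp add: s_def A_def algebra_simps)
      with 1 show ?thesis by simp
    qed
    have fw_meas: "(\<lambda>\<omega>. \<integral>x. w x / W * f \<omega> x \<partial>unif01) \<in> borel_measurable M"
    proof (rule unif01.borel_measurable_lebesgue_integral)
      note f_meas[measurable]
      have "(\<lambda>(\<omega>, x). w x / W * f \<omega> x) \<in> borel_measurable (M \<Otimes>\<^sub>M borel)" by measurable
      then show "(\<lambda>(\<omega>, x). w x / W * f \<omega> x) \<in> borel_measurable (M \<Otimes>\<^sub>M unif01)"
        by (simp cong: measurable_cong_sets sets_pair_measure_cong)
    qed
    have "prob {\<omega>\<in>space M. k < (\<integral>x. \<bar>G N x \<omega>\<bar> \<partial>unif01) \<and> \<bar>norm_sum N lin \<omega>\<bar> \<le> k - \<eta>}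
      \<le> prob {\<omega>\<in>space M. s < (\<integral>x. w x / W * f \<omega> x \<partial>unif01)}"
      using key fw_meas by (intro finite_measure_mono) (auto simp: I_def)
    also have "\<dots> \<le> exp (- l * s) * (4 * ?E)"
    proof (rule prob_weighted_average_gt_le[OF f_meas, where R="sqrt (real N) * B" and c="(1/2) / W"])
      show "\<bar>f \<omega> x\<bar> \<le> sqrt (real N) * B" if "\<omega> \<in> space M" for \<omega> x
        using abs_norm_sum_le[OF that linB, where N=N] abs_norm_sum_le[OF that JB, where N=N] by (simp add: f_def I_def J_def)
      show "0 \<le> w x / W" "w x / W \<le> (1/2) / W" for x
        using wpos[of x] Wpos divide_right_mono[OF w_bounds(2)[of x], of W] by auto
      show "(\<integral>x. w x / W \<partial>unif01) = 1"
        using Wpos by (simp add: W_def[symmetric])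
      show "expectation (\<lambda>\<omega>. exp (l * f \<omega> x)) \<le> 4 * ?E" for x by (rule fmgf)
    qed (use l0 in auto)
    also have "\<dots> = 4 * exp (- (2 * s\<^sup>2) + (l ^ 3 * B ^ 3) / sqrt (real N))"
    proof -
      have "- l * s + l\<^sup>2 * (1/4) / 2 = - (2 * s\<^sup>2)"
        by (simp add: l_def power2_eq_square)
      then show ?thesis by (simp flip: exp_add)
    qed
    finally show ?thesis .
  qed
  have "\<forall>\<^sub>F N in sequentially. prob {\<omega>\<in>space M. k < (\<integral>x. \<bar>G N x \<omega>\<bar> \<partial>unif01) \<and> \<bar>norm_sum N lin \<omega>\<bar> \<le> k - \<eta>}
    \<le> 4 * exp (- (2 * s\<^sup>2) + (l ^ 3 * B ^ 3) / sqrt (real N))"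
    using eventually_sqrt_ge[of "l * B"] by eventually_elim (use bound in auto)
  then show ?thesis unfolding s_def by blast
qed

end

section \<open>The normal tail\<close>

interpretation std_normal: real_distribution std_normal_distribution
  by (rule real_dist_normal_dist)

lemma std_normal_cdf_diff_bounds:
  assumes ab: "a \<le> b" and c: "\<And>x. a < x \<Longrightarrow> x \<le> b \<Longrightarrow> c \<le> std_normal_density x \<and> std_normal_density x \<le> C"
  shows "c * (b - a) \<le> std_normal_cdf b - std_normal_cdf a" "std_normal_cdf b - std_normal_cdf a \<le> C * (b - a)"
proof -
  have diff: "std_normal_cdf b - std_normal_cdf a = measure std_normal_distribution {a<..b}"
    using ab by (cases "a = b") (auto simp: std_normal.cdf_diff_eq)
  have m: "measure std_normal_distribution {a<..b} = (\<integral>x. std_normal_density x * indicator {a<..b} x \<partial>lborel)"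
  proof -
    have "measure std_normal_distribution {a<..b} = (\<integral>x. indicator {a<..b} x \<partial>std_normal_distribution)" by simp
    also have "\<dots> = (\<integral>x. std_normal_density x * indicator {a<..b} x \<partial>lborel)"
      by (subst integral_density) auto
    finally show ?thesis .
  qed
  have i: "integrable lborel (\<lambda>x. std_normal_density x * indicator {a<..b} x)"
    by (rule integrable_mult_indicator[of "{a<..b}" lborel std_normal_density, simplified mult.commute real_scaleR_def])
      (auto simp: mult.commute)
  have ci: "(\<integral>x. r * indicator {a<..b} x \<partial>lborel) = r * (b - a)"
    "integrable lborel (\<lambda>x. r * indicator {a<..b} x)" for r :: real
    using ab by auto
  have "(\<integral>x. c * indicator {a<..b} x \<partial>lborel) \<le> (\<integral>x. std_normal_density x * indicator {a<..b} x \<partial>lborel)"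
    using c by (intro integral_mono ci i) (auto simp: indicator_def)
  then show "c * (b - a) \<le> std_normal_cdf b - std_normal_cdf a"
    by (simp only: diff m ci)
  have "(\<integral>x. std_normal_density x * indicator {a<..b} x \<partial>lborel) \<le> (\<integral>x. C * indicator {a<..b} x \<partial>lborel)"
    using c by (intro integral_mono ci i) (auto simp: indicator_def)
  then show "std_normal_cdf b - std_normal_cdf a \<le> C * (b - a)"
    by (simp only: diff m ci)
qed

lemma std_normal_density_antimono: "\<bar>x\<bar> \<le> \<bar>y\<bar> \<Longrightarrow> std_normal_density y \<le> std_normal_density x"
  by (auto simp: std_normal_density_def abs_le_square_iff intro!: divide_right_mono)

lemma strict_mono_std_normal_cdf: "strict_mono std_normal_cdf"
proof (rule strict_monoI)
  fix a b :: real assume "a < b"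
  define m where "m = max \<bar>a\<bar> \<bar>b\<bar>"
  have "std_normal_density m * (b - a) \<le> std_normal_cdf b - std_normal_cdf a"
    using \<open>a < b\<close>
    by (intro std_normal_cdf_diff_bounds(1)[where C="std_normal_density 0"] conjI std_normal_density_antimono)
      (auto simp: m_def)
  moreover have "0 < std_normal_density m * (b - a)"
    using \<open>a < b\<close> by (simp add: normal_density_pos)
  ultimately show "std_normal_cdf a < std_normal_cdf b" by linarith
qed

lemma measure_std_normal_singleton: "measure std_normal_distribution {x} = 0"
proof -
  have "AE y in lborel. ennreal (std_normal_density y) * indicator {x} y = 0"
    using AE_lborel_singleton[of x] by eventually_elim auto
  then have "(\<integral>\<^sup>+y. ennreal (std_normal_density y) * indicator {x} y \<partial>lborel) = 0"
    by (subst nn_integral_0_iff_AE) auto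
  then have "emeasure std_normal_distribution {x} = 0"
    by (subst emeasure_density) auto
  then show ?thesis by (simp add: measure_def)
qed

lemma isCont_std_normal_cdf: "isCont std_normal_cdf x"
  by (simp add: std_normal.isCont_cdf measure_std_normal_singleton)

text \<open>The density is even and single points carry no mass.\<close>

lemma std_normal_cdf_minus: "std_normal_cdf (- x) = 1 - std_normal_cdf x"
proof -
  have int: "measure std_normal_distribution A = (\<integral>y. std_normal_density y * indicator A y \<partial>lborel)"
    if "A \<in> sets borel" for A
  proof -
    have "measure std_normal_distribution A = (\<integral>y. indicator A y \<partial>std_normal_distribution)"
      using that by simp
    also have "\<dots> = (\<integral>y. std_normal_density y * indicator A y \<partial>lborel)"
      using that by (subst integral_density) auto
    finally show ?thesis .
  qed
  have "std_normal_cdf (- x) = (\<integral>y. std_normal_density y * indicator {..-x} y \<partial>lborel)"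
    unfolding cdf_def by (rule int) simp
  also have "\<dots> = (\<integral>y. std_normal_density (- y) * indicator {..-x} (- y) \<partial>lborel)"
    using lborel_integral_real_affine[of "-1" "\<lambda>y. std_normal_density y * indicator {..-x} y" 0] by simp
  also have "\<dots> = (\<integral>y. std_normal_density y * indicator {x..} y \<partial>lborel)"
    by (intro Bochner_Integration.integral_cong) (auto simp: std_normal_density_def indicator_def)
  also have "\<dots> = measure std_normal_distribution {x..}"
    by (rule int[symmetric]) simp
  also have "{x..} = (space std_normal_distribution - {..x}) \<union> {x}" by auto
  also have "measure std_normal_distribution \<dots> = 1 - std_normal_cdf x"
    by (subst std_normal.finite_measure_Union)
      (use std_normal.prob_compl[of "{..x}"] in \<open>auto simp: cdf_def measure_std_normal_singleton\<close>)
  finally show ?thesis .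
qed

lemma std_normal_cdf_less_1: "std_normal_cdf x < 1"
  using strict_monoD[OF strict_mono_std_normal_cdf, of x "x + 1"] std_normal.cdf_bounded_prob[of "x + 1"]
  by simp

text \<open>Only the mass of (z, z + 1/z] is kept. The width 1/z is the decay scale of the density
  at z, so for large z just a constant factor is lost.\<close>

lemma std_normal_upper_tail_ge:
  assumes "0 < z"
  shows "std_normal_density (z + 1 / z) / z \<le> 1 - std_normal_cdf z"
proof -
  have "std_normal_density (z + 1 / z) * ((z + 1 / z) - z) \<le> std_normal_cdf (z + 1 / z) - std_normal_cdf z"
    using assms
    by (intro std_normal_cdf_diff_bounds(1)[where C="std_normal_density 0"] conjI std_normal_density_antimono) auto
  also have "\<dots> \<le> 1 - std_normal_cdf z"
    using std_normal.cdf_bounded_prob by simp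
  finally show ?thesis by simp
qed

text \<open>
  The exponents only have to satisfy, as \<open>z \<rightarrow> \<infinity>\<close>, that \<open>z * shrink z\<close> tends to 0 while
  \<open>z * gain z * shrink z\<close> and \<open>z\<^sup>2 * (spread z)\<^sup>2\<close> grow faster than \<open>ln z\<close>.
\<close>

definition shrink :: "real \<Rightarrow> real" where "shrink z = z powr (-6/5)"

definition spread :: "real \<Rightarrow> real" where "spread z = z powr (-9/10)"

definition gain :: "real \<Rightarrow> real" where "gain z = 1 / (4 * sqrt (2 * spread z))"

text \<open>The limits for N to infinity of the near bound, with k = z / 2 and \<eta> =
  \<open>shrink z / 2\<close>, and of the far bound. Adding both gives one function of z that serves
  every law.\<close>

definition gauss_err :: "real \<Rightarrow> real" where
  "gauss_err z = 4 * exp (- (2 * (z / 2 + (gain z - 1) * (shrink z / 2))\<^sup>2))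
    + 2 * exp (- (2 * (z / 2)\<^sup>2 * (1 + 4 * (spread z)\<^sup>2)))"

text \<open>The first summand is the central limit contribution of |I| > (z -
  \<open>shrink z\<close>) / 2, where the standard deviation of I is at most 1/2.\<close>

definition tail_bound :: "real \<Rightarrow> real" where
  "tail_bound z = 2 * (1 - std_normal_cdf (z - shrink z)) + gauss_err z"

lemma gauss_err_nonneg: "0 \<le> gauss_err z"
  by (simp add: gauss_err_def add_nonneg_nonneg)

section \<open>Asymptotics of the tail bound\<close>

lemma eventually_parameters:
  "\<forall>\<^sub>F z in at_top. 0 < z \<and> shrink z < z \<and> 1 \<le> gain z"
proof (intro eventually_conj)
  show "\<forall>\<^sub>F z in at_top. 0 < (z::real)" by (rule eventually_gt_at_top)
  show "\<forall>\<^sub>F z in at_top. shrink z < z" unfolding shrink_def by real_asymp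
  show "\<forall>\<^sub>F z in at_top. 1 \<le> gain z" unfolding gain_def spread_def by real_asymp
qed

text \<open>Dividing by the lower bound of the normal tail multiplies by
  \<open>exp ((z + 1 / z)\<^sup>2 / 2)\<close>, which cancels the leading Gaussian decay. What
  remains is explicit in powers of z and \<open>exp\<close>, so that its limit can be
  computed.\<close>

lemma relative_error_le:
  assumes z: "0 < z" and g: "1 \<le> gain z"
  shows "(2 * shrink z * std_normal_density (z - shrink z) + gauss_err z) / (2 * (std_normal_density (z + 1 / z) / z))
    \<le> z powr (-6/5) * z * exp ((z + 1 / z)\<^sup>2 / 2 - (z - z powr (-6/5))\<^sup>2 / 2)
      + sqrt (2 * pi) / 2 * (4 * (z * exp (1 + 1 / (2 * z\<^sup>2) - (1 / (4 * sqrt (2 * z powr (-9/10))) - 1) * z powr (-1/5)))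
      + 2 * (z * exp (1 + 1 / (2 * z\<^sup>2) - 2 * z powr (1/5))))"
proof -
  define s where "s = shrink z"
  define q where "q = sqrt (2 * pi)"
  define u where "u = (z + 1 / z)\<^sup>2 / 2"
  define h where "h = (gain z - 1) * (s / 2)"
  have q: "0 < q" by (simp add: q_def)
  have u: "u = z\<^sup>2 / 2 + 1 + 1 / (2 * z\<^sup>2)"
  proof -
    have "(z + 1 / z)\<^sup>2 = z\<^sup>2 + 2 + 1 / z\<^sup>2"
      using z by (simp add: power2_sum power_divide)
    then show ?thesis unfolding u_def by (simp add: add_divide_distrib)
  qed
  have dens: "std_normal_density x = exp (- x\<^sup>2 / 2) / q" for x
    by (simp add: std_normal_density_def q_def)
  have s0: "0 \<le> s" by (simp add: s_def shrink_def)
  have zs: "z * s = z powr (-1/5)"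
    using z powr_mult_base[of z "-6/5"] by (simp add: s_def shrink_def)
  have zt: "z\<^sup>2 * (spread z)\<^sup>2 = z powr (1/5)"
  proof -
    have "z * spread z = z powr (1/10)"
      using z powr_mult_base[of z "-9/10"] by (simp add: spread_def)
    then have "z\<^sup>2 * (spread z)\<^sup>2 = (z powr (1/10))\<^sup>2" by (simp flip: power_mult_distrib)
    also have "\<dots> = z powr (1/5)" by (simp add: power2_eq_square flip: powr_add)
    finally show ?thesis .
  qed
  \<comment> \<open>Of the expanded square only the cross term is used: it alone outgrows ln z, and
    \<open>2 * h\<^sup>2\<close> is dropped.\<close>
  have e1: "u - 2 * (z / 2 + h)\<^sup>2 \<le> 1 + 1 / (2 * z\<^sup>2) - (gain z - 1) * z powr (-1/5)"
  proof -
    have "2 * (z / 2 + h)\<^sup>2 = z\<^sup>2 / 2 + 2 * z * h + 2 * h\<^sup>2"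
      by (simp add: power2_eq_square algebra_simps)
    moreover have "2 * z * h = (gain z - 1) * (z * s)"
      by (simp add: h_def)
    ultimately have "u - 2 * (z / 2 + h)\<^sup>2 = 1 + 1 / (2 * z\<^sup>2) - (gain z - 1) * (z * s) - 2 * h\<^sup>2"
      unfolding u by linarith
    then show ?thesis unfolding zs using zero_le_power2[of h] by linarith
  qed
  have e2: "u - 2 * (z / 2)\<^sup>2 * (1 + 4 * (spread z)\<^sup>2) = 1 + 1 / (2 * z\<^sup>2) - 2 * z powr (1/5)"
  proof -
    have "2 * (z / 2)\<^sup>2 * (1 + 4 * b) = z\<^sup>2 / 2 + 2 * (z\<^sup>2 * b)" for b
      by (simp add: power2_eq_square distrib_left)
    then show ?thesis unfolding u zt[symmetric] by simp
  qed
  have B: "2 * (std_normal_density (z + 1 / z) / z) = 2 / (z * q * exp u)"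
  proof -
    have "exp (- (z + 1 / z)\<^sup>2 / 2) = inverse (exp u)"
      unfolding u_def exp_minus[symmetric] by (simp only: minus_divide_left)
    moreover have "2 * (inverse e / q / z) = 2 / (z * q * e)" for e :: real
      by (simp only: divide_inverse inverse_mult_distrib mult_ac)
    ultimately show ?thesis unfolding dens by (simp only:)
  qed
  have E: "exp (u - (z - s)\<^sup>2 / 2) = exp (- (z - s)\<^sup>2 / 2) * exp u"
    by (simp flip: exp_add)
  have A: "2 * s * (b / q) * (z * q * e / 2) = s * z * (b * e)" for b e :: real
    using q by simp
  have "(2 * s * std_normal_density (z - s) + gauss_err z) / (2 * (std_normal_density (z + 1 / z) / z))
    = 2 * s * (exp (- (z - s)\<^sup>2 / 2) / q) * (z * q * exp u / 2) + gauss_err z * (z * q * exp u / 2)"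
  proof -
    have "(a + b) / (2 / w) = a * (w / 2) + b * (w / 2)" for a b w :: real
      by (simp add: distrib_right add_divide_distrib)
    then show ?thesis unfolding B unfolding dens by blast
  qed
  also have "\<dots> = s * z * exp (u - (z - s)\<^sup>2 / 2) + q / 2 * (z * (gauss_err z * exp u))"
    unfolding A E by simp
  also have "gauss_err z * exp u = 4 * exp (u - 2 * (z / 2 + h)\<^sup>2) + 2 * exp (u - 2 * (z / 2)\<^sup>2 * (1 + 4 * (spread z)\<^sup>2))"
  proof -
    have E: "exp (u - b) = exp (- b) * exp u" for b by (simp flip: exp_add)
    show ?thesis unfolding E gauss_err_def h_def s_def by (simp add: distrib_right)
  qed
  also have "s * z * exp (u - (z - s)\<^sup>2 / 2) + q / 2 * (z * \<dots>)
    \<le> s * z * exp (u - (z - s)\<^sup>2 / 2) + q / 2 * (z * (4 * exp (1 + 1 / (2 * z\<^sup>2) - (gain z - 1) * z powr (-1/5))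
      + 2 * exp (1 + 1 / (2 * z\<^sup>2) - 2 * z powr (1/5))))"
    unfolding e2 using q z e1 s0 by (intro add_mono mult_left_mono) auto
  finally show ?thesis
    unfolding s_def q_def u_def shrink_def gain_def spread_def
    by (simp only: distrib_left mult.left_commute[of z])
qed

text \<open>The excess n of \<open>tail_bound\<close> over the two-sided normal tail d is
  nonnegative, and n / d is at most r, which tends to 0. Shifting the threshold by
  \<open>shrink z\<close> costs at most that length times the density at the lower end.\<close>

lemma tail_bound_asymp:
  "((\<lambda>z. tail_bound z / (2 * (1 - std_normal_cdf z))) \<longlongrightarrow> 1) at_top"
proof -
  define r :: "real \<Rightarrow> real" where "r z = z powr (-6/5) * z * exp ((z + 1 / z)\<^sup>2 / 2 - (z - z powr (-6/5))\<^sup>2 / 2)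
      + sqrt (2 * pi) / 2 * (4 * (z * exp (1 + 1 / (2 * z\<^sup>2) - (1 / (4 * sqrt (2 * z powr (-9/10))) - 1) * z powr (-1/5)))
      + 2 * (z * exp (1 + 1 / (2 * z\<^sup>2) - 2 * z powr (1/5))))" for z
  have lim: "(r \<longlongrightarrow> 0) at_top"
  proof -
    have "((\<lambda>z::real. z powr (-6/5) * z * exp ((z + 1 / z)\<^sup>2 / 2 - (z - z powr (-6/5))\<^sup>2 / 2)) \<longlongrightarrow> 0) at_top"
      "((\<lambda>z::real. z * exp (1 + 1 / (2 * z\<^sup>2) - (1 / (4 * sqrt (2 * z powr (-9/10))) - 1) * z powr (-1/5))) \<longlongrightarrow> 0) at_top"
      "((\<lambda>z::real. z * exp (1 + 1 / (2 * z\<^sup>2) - 2 * z powr (1/5))) \<longlongrightarrow> 0) at_top"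
      by real_asymp+
    then have "(r \<longlongrightarrow> 0 + sqrt (2 * pi) / 2 * (4 * 0 + 2 * 0)) at_top"
      unfolding r_def by (intro tendsto_add tendsto_mult tendsto_const)
    then show ?thesis by simp
  qed
  have "\<forall>\<^sub>F z in at_top. 1 \<le> tail_bound z / (2 * (1 - std_normal_cdf z))
    \<and> tail_bound z / (2 * (1 - std_normal_cdf z)) \<le> 1 + r z"
    using eventually_parameters
  proof eventually_elim
    case (elim z)
    define d where "d = 2 * (1 - std_normal_cdf z)"
    define n where "n = 2 * (std_normal_cdf z - std_normal_cdf (z - shrink z)) + gauss_err z"
    have sh: "0 \<le> shrink z" by (simp add: shrink_def)
    have d0: "0 < d" using std_normal_cdf_less_1[of z] by (simp add: d_def)
    have t: "tail_bound z = d + n" by (simp add: tail_bound_def d_def n_def)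
    have n0: "0 \<le> n"
      using gauss_err_nonneg[of z] std_normal.cdf_nondecreasing[of "z - shrink z" z] sh by (simp add: n_def)
    have "std_normal_cdf z - std_normal_cdf (z - shrink z) \<le> std_normal_density (z - shrink z) * (z - (z - shrink z))"
      using elim sh
      by (intro std_normal_cdf_diff_bounds(2)[where c=0] conjI std_normal_density_antimono)
        auto
    then have n: "n \<le> 2 * shrink z * std_normal_density (z - shrink z) + gauss_err z"
      by (simp add: n_def mult_ac)
    have "n / d \<le> (2 * shrink z * std_normal_density (z - shrink z) + gauss_err z) / (2 * (std_normal_density (z + 1 / z) / z))"
    proof (rule frac_le)
      show "2 * (std_normal_density (z + 1 / z) / z) \<le> d"
        using std_normal_upper_tail_ge[of z] elim by (simp add: d_def)
    qed (use n n0 elim in \<open>auto simp: normal_density_pos\<close>)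
    also have "\<dots> \<le> r z"
      unfolding r_def using elim by (intro relative_error_le) auto
    finally have "n / d \<le> r z" .
    then show ?case
      unfolding t d_def[symmetric] using d0 n0 by (simp add: add_divide_distrib)
  qed
  then have ev: "\<forall>\<^sub>F z in at_top. 1 \<le> tail_bound z / (2 * (1 - std_normal_cdf z))"
     "\<forall>\<^sub>F z in at_top. tail_bound z / (2 * (1 - std_normal_cdf z)) \<le> 1 + r z"
    by (auto elim: eventually_mono)
  show ?thesis
    by (rule tendsto_sandwich[OF ev]) (use tendsto_add[OF tendsto_const[of 1] lim] in auto)
qed

section \<open>Asymptotic confidence\<close>

context iid_unit_samples
begin

section \<open>The limiting tail of the integrated absolute process\<close>

text \<open>By the central limit theorem the limit is the two-sided normal tail at c / s, where s is
  at most 1/2. A convergent majorant a keeps limits superior out of the later estimates.\<close>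

lemma prob_abs_norm_sum_lin_gt:
  assumes c: "0 \<le> c"
  shows "\<exists>a L. (\<forall>N. prob {\<omega>\<in>space M. c < \<bar>norm_sum N lin \<omega>\<bar>} \<le> a N) \<and> a \<longlonglongrightarrow> L
    \<and> L \<le> 2 * (1 - std_normal_cdf (2 * c))"
proof -
  define v where "v = expectation (\<lambda>\<omega>. (lin (X 0 \<omega>))\<^sup>2)"
  have v: "0 \<le> v" "v \<le> 1/4" using variance_lin by (auto simp: v_def)
  have vi: "expectation (\<lambda>\<omega>. (lin (X i \<omega>))\<^sup>2) = v" for i
    unfolding v_def by (rule expectation_identical[where h="\<lambda>y. (lin y)\<^sup>2"]) measurable
  have i2: "integrable M (\<lambda>\<omega>. (lin (X i \<omega>))\<^sup>2)" for i
  proof (rule integrable_X_bounded[where h="\<lambda>y. (lin y)\<^sup>2" and B=1])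
    show "\<bar>(lin y)\<^sup>2\<bar> \<le> 1" if "y \<in> {0..1}" for y
      using power_mono[OF abs_lin_le[OF that], of 2] by simp
  qed measurable
  show ?thesis
  proof (cases "v = 0")
    \<comment> \<open>The theorem needs positive variance; with variance 0 the summands vanish
      almost surely.\<close>
    case True
    have "AE \<omega> in M. \<forall>i. lin (X i \<omega>) = 0"
      unfolding AE_all_countable
    proof
      fix i
      have "AE \<omega> in M. (lin (X i \<omega>))\<^sup>2 = 0"
        using integral_nonneg_eq_0_iff_AE[OF i2[of i]] vi[of i] True by simp
      then show "AE \<omega> in M. lin (X i \<omega>) = 0" by simp
    qed
    then have z: "AE \<omega> in M. norm_sum N lin \<omega> = 0" for N
      by eventually_elim (simp add: norm_sum_def)
    have "prob {\<omega>\<in>space M. c < \<bar>norm_sum N lin \<omega>\<bar>} = 0" for N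
    proof (subst prob_Collect_eq_0)
      show "AE \<omega> in M. \<not> c < \<bar>norm_sum N lin \<omega>\<bar>"
        using z[of N] by eventually_elim (use c in simp)
    qed measurable
    then show ?thesis
      using std_normal_cdf_less_1[of "2 * c"]
      by (intro exI[of _ "\<lambda>_. 0"] exI[of _ 0]) auto
  next
    case False
    then have v0: "0 < v" using v by simp
    define s where "s = sqrt v"
    have s: "0 < s" "s \<le> 1/2" "s\<^sup>2 = v"
      using v v0 real_sqrt_le_mono[OF v(2)] by (auto simp: s_def real_sqrt_divide)
    have mean: "expectation (\<lambda>\<omega>. lin (X i \<omega>)) = 0" for i
      using expectation_identical[OF measurable_lin, of i] expectation_lin by simp
    have clt: "weak_conv_m (\<lambda>n. distr M borel (\<lambda>\<omega>. (\<Sum>i<n. lin (X i \<omega>)) / sqrt (n * s\<^sup>2))) std_normal_distribution"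
    proof (rule central_limit_theorem_zero_mean)
      show "indep_vars (\<lambda>i. borel) (\<lambda>i \<omega>. lin (X i \<omega>)) UNIV"
        by (rule indep_vars_compose2[OF indep]) measurable
      show "variance (\<lambda>\<omega>. lin (X i \<omega>)) = s\<^sup>2" for i
        by (simp add: mean vi s)
      have "distr M borel (\<lambda>\<omega>. lin (X i \<omega>)) = distr (distr M borel (X i)) borel lin" for i
        by (subst distr_distr) (auto simp: comp_def)
      then show "distr M borel (\<lambda>\<omega>. lin (X i \<omega>)) = distr (distr M borel (X 0)) borel lin" for i
        by (simp only: identical[of i])
    qed (use s mean i2 in auto)
    define C where "C n x = prob {\<omega>\<in>space M. norm_sum n lin \<omega> / s \<le> x}" for n x
    have Clim: "(\<lambda>n. C n x) \<longlonglongrightarrow> std_normal_cdf x" for x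
    proof -
      have "cdf (distr M borel (\<lambda>\<omega>. (\<Sum>i<n. lin (X i \<omega>)) / sqrt (n * s\<^sup>2))) x = C n x" for n
      proof -
        have eq: "(\<Sum>i<n. lin (X i \<omega>)) / sqrt (n * s\<^sup>2) = norm_sum n lin \<omega> / s" for \<omega>
          using s(1) by (simp add: norm_sum_def real_sqrt_mult)
        show ?thesis
          unfolding eq C_def cdf_def
          by (subst measure_distr) (auto intro!: arg_cong[where f=prob])
      qed
      moreover have "(\<lambda>n. cdf (distr M borel (\<lambda>\<omega>. (\<Sum>i<n. lin (X i \<omega>)) / sqrt (n * s\<^sup>2))) x) \<longlonglongrightarrow> std_normal_cdf x"
        using clt isCont_std_normal_cdf[of x] unfolding weak_conv_m_def weak_conv_def by blast
      ultimately show ?thesis by (simp only:)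
    qed
    \<comment> \<open>The lower event is enlarged to \<open>\<le>\<close>, so that both terms are
      values of distribution functions with known limits.\<close>
    define a where "a n = 1 - C n (c / s) + C n (- (c / s))" for n
    have "prob {\<omega>\<in>space M. c < \<bar>norm_sum n lin \<omega>\<bar>} \<le> a n" for n
    proof -
      let ?U = "{\<omega>\<in>space M. norm_sum n lin \<omega> / s \<le> c / s}" and ?V = "{\<omega>\<in>space M. norm_sum n lin \<omega> / s \<le> - (c / s)}"
      have "prob {\<omega>\<in>space M. c < \<bar>norm_sum n lin \<omega>\<bar>} \<le> prob ((space M - ?U) \<union> ?V)"
      proof (intro finite_measure_mono subsetI)
        fix \<omega> assume "\<omega> \<in> {\<omega>\<in>space M. c < \<bar>norm_sum n lin \<omega>\<bar>}"
        then have w: "\<omega> \<in> space M" and "c < norm_sum n lin \<omega> \<or> norm_sum n lin \<omega> < - c" by auto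
        then have "c / s < norm_sum n lin \<omega> / s \<or> norm_sum n lin \<omega> / s < (- c) / s"
          using divide_strict_right_mono[OF _ s(1)] by blast
        then show "\<omega> \<in> (space M - ?U) \<union> ?V" using w by auto
      qed measurable
      also have "\<dots> \<le> prob (space M - ?U) + prob ?V"
        by (intro measure_Un_le) auto
      also have "prob (space M - ?U) = 1 - prob ?U" by (intro prob_compl) auto
      finally show ?thesis by (simp add: a_def C_def)
    qed
    moreover have "a \<longlonglongrightarrow> 1 - std_normal_cdf (c / s) + std_normal_cdf (- (c / s))"
      unfolding a_def by (intro tendsto_intros Clim)
    moreover have "1 - std_normal_cdf (c / s) + std_normal_cdf (- (c / s)) \<le> 2 * (1 - std_normal_cdf (2 * c))"
    proof -
      have "2 * c * s \<le> c" using mult_left_mono[OF s(2), of "2 * c"] c by simp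
      then have "2 * c \<le> c / s" using s by (simp add: pos_le_divide_eq)
      then have "std_normal_cdf (2 * c) \<le> std_normal_cdf (c / s)"
        by (rule std_normal.cdf_nondecreasing)
      then show ?thesis by (simp add: std_normal_cdf_minus)
    qed
    ultimately show ?thesis by blast
  qed
qed

lemma measurable_integral_abs_G [measurable]:
  "(\<lambda>\<omega>. \<integral>x. \<bar>G N x \<omega>\<bar> \<partial>unif01) \<in> borel_measurable M"
proof (rule unif01.borel_measurable_lebesgue_integral)
  have "(\<lambda>(\<omega>, x). \<bar>G N x \<omega>\<bar>) \<in> borel_measurable (M \<Otimes>\<^sub>M borel)" by measurable
  then show "(\<lambda>(\<omega>, x). \<bar>G N x \<omega>\<bar>) \<in> borel_measurable (M \<Otimes>\<^sub>M unif01)"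
    by (simp cong: measurable_cong_sets sets_pair_measure_cong)
qed

text \<open>In the near case either |I| exceeds (z - \<open>shrink z\<close>) / 2, to which the
  central limit theorem applies, or the penalised bound does; the far case has a single bound.
  Either limit is part of the sum \<open>tail_bound z\<close>, whose other terms are
  nonnegative.\<close>

theorem prob_integral_abs_gt:
  assumes z: "0 < z" "shrink z < z" "1 \<le> gain z"
  shows "\<exists>a L. (\<forall>\<^sub>F N in sequentially. prob {\<omega>\<in>space M. z / 2 < (\<integral>x. \<bar>G N x \<omega>\<bar> \<partial>unif01)} \<le> a N)
    \<and> a \<longlonglongrightarrow> L \<and> L \<le> tail_bound z"
proof -
  have sp: "0 < spread z" and sh: "0 < shrink z" using z by (auto simp: spread_def shrink_def)
  have inv_sqrt: "(\<lambda>N. c / sqrt (real N)) \<longlonglongrightarrow> 0" for c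
    by (rule real_tendsto_divide_at_top[OF tendsto_const])
      (rule filterlim_compose[OF sqrt_at_top filterlim_real_sequentially])
  have exp_lim: "(\<lambda>N. r * exp (b + c / sqrt (real N))) \<longlonglongrightarrow> r * exp b" for r b c
  proof -
    have "(\<lambda>N. r * exp (b + c / sqrt (real N))) \<longlonglongrightarrow> r * exp (b + 0)"
      by (intro tendsto_mult tendsto_const tendsto_exp tendsto_add inv_sqrt)
    then show ?thesis by simp
  qed
  show ?thesis
  proof (cases "dev \<le> spread z")
    case True
    have half: "0 < shrink z / 2" "shrink z / 2 < z / 2" using z sh by auto
    have gain: "gain z \<le> 1 / (4 * sqrt (2 * spread z))" unfolding gain_def ..
    obtain c where c: "\<forall>\<^sub>F N in sequentially.
        prob {\<omega>\<in>space M. z / 2 < (\<integral>x. \<bar>G N x \<omega>\<bar> \<partial>unif01) \<and> \<bar>norm_sum N lin \<omega>\<bar> \<le> z / 2 - shrink z / 2}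
      \<le> 4 * exp (- (2 * (z / 2 + (gain z - 1) * (shrink z / 2))\<^sup>2) + c / sqrt (real N))"
      using prob_integral_abs_gt_near[OF half sp True z(3) gain] by blast
    obtain a L where a: "\<And>N. prob {\<omega>\<in>space M. z / 2 - shrink z / 2 < \<bar>norm_sum N lin \<omega>\<bar>} \<le> a N"
      and L: "a \<longlonglongrightarrow> L" "L \<le> 2 * (1 - std_normal_cdf (2 * (z / 2 - shrink z / 2)))"
      using prob_abs_norm_sum_lin_gt[of "z / 2 - shrink z / 2"] half(2) by force
    let ?E = "4 * exp (- (2 * (z / 2 + (gain z - 1) * (shrink z / 2))\<^sup>2))"
    have "\<forall>\<^sub>F N in sequentially. prob {\<omega>\<in>space M. z / 2 < (\<integral>x. \<bar>G N x \<omega>\<bar> \<partial>unif01)}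
      \<le> a N + 4 * exp (- (2 * (z / 2 + (gain z - 1) * (shrink z / 2))\<^sup>2) + c / sqrt (real N))"
      using c
    proof eventually_elim
      case (elim N)
      let ?A = "{\<omega>\<in>space M. z / 2 - shrink z / 2 < \<bar>norm_sum N lin \<omega>\<bar>}"
      let ?B = "{\<omega>\<in>space M. z / 2 < (\<integral>x. \<bar>G N x \<omega>\<bar> \<partial>unif01) \<and> \<bar>norm_sum N lin \<omega>\<bar> \<le> z / 2 - shrink z / 2}"
      have "prob {\<omega>\<in>space M. z / 2 < (\<integral>x. \<bar>G N x \<omega>\<bar> \<partial>unif01)} \<le> prob (?A \<union> ?B)"
        by (intro finite_measure_mono) auto
      also have "\<dots> \<le> prob ?A + prob ?B"
        by (intro measure_Un_le) auto
      finally show ?case using a[of N] elim by linarith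
    qed
    moreover have "(\<lambda>N. a N + 4 * exp (- (2 * (z / 2 + (gain z - 1) * (shrink z / 2))\<^sup>2) + c / sqrt (real N))) \<longlonglongrightarrow> L + ?E"
      by (intro tendsto_add L exp_lim)
    moreover have "L + ?E \<le> tail_bound z"
    proof -
      have "2 * (z / 2 - shrink z / 2) = z - shrink z" by simp
      from L(2)[unfolded this] show ?thesis
        using exp_ge_zero[of "- (2 * (z / 2)\<^sup>2 * (1 + 4 * (spread z)\<^sup>2))"]
        unfolding tail_bound_def gauss_err_def by linarith
    qed
    ultimately show ?thesis by (intro exI conjI)
  next
    case False
    then have far: "spread z \<le> dev" by simp
    have half_pos: "0 < z / 2" using z by simp
    obtain c where c: "\<forall>\<^sub>F N in sequentially. prob {\<omega>\<in>space M. z / 2 < (\<integral>x. \<bar>G N x \<omega>\<bar> \<partial>unif01)}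
      \<le> 2 * exp (- (2 * (z / 2)\<^sup>2 * (1 + 4 * (spread z)\<^sup>2)) + c / sqrt (real N))"
      using prob_integral_abs_gt_far[of "z / 2" "spread z"] half_pos less_imp_le[OF sp] far by blast
    have "2 * exp (- (2 * (z / 2)\<^sup>2 * (1 + 4 * (spread z)\<^sup>2))) \<le> tail_bound z"
    proof -
      have "e \<le> 2 * (1 - p) + (4 * d + e)" if "p < 1" "0 \<le> d" for p d e :: real
        using mult_nonneg_nonneg[of 2 "1 - p"] that by simp
      from this[OF std_normal_cdf_less_1 exp_ge_zero] show ?thesis
        unfolding tail_bound_def gauss_err_def .
    qed
    then show ?thesis using c exp_lim by (intro exI conjI)
  qed
qed

end

section \<open>Transfer to the product measure\<close>

lemma iid_law_iid_unit_samples: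
  assumes P: "P \<in> borel_probs"
  shows "iid_unit_samples (iid_law P) (\<lambda>i \<omega>. \<omega> i)"
proof -
  interpret P: prob_space P using P by (rule borel_probsD)
  have ps: "prob_space (iid_law P)"
    unfolding iid_law_def by (rule prob_space_PiM) (rule P.prob_space_axioms)
  interpret prob_space "iid_law P" by (rule ps)
  have sp: "space (iid_law P) = {\<omega>. \<forall>i. \<omega> i \<in> {0..1}}"
    by (auto simp: iid_law_def space_PiM borel_probsD(3)[OF P] PiE_def Pi_def)
  have comp: "(\<lambda>\<omega>. \<omega> i) \<in> iid_law P \<rightarrow>\<^sub>M P" for i :: nat
    unfolding iid_law_def by (rule measurable_component_singleton) simp
  have d: "distr (iid_law P) P (\<lambda>\<omega>. \<omega> i) = P" for i :: nat
    unfolding iid_law_def by (rule distr_PiM_component) (auto simp: P.prob_space_axioms)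
  have "indep_vars (\<lambda>_. P) (\<lambda>i \<omega>. \<omega> i) (UNIV :: nat set)"
  proof (subst indep_vars_iff_distr_eq_PiM')
    show "distr (iid_law P) (Pi\<^sub>M UNIV (\<lambda>_. P)) (\<lambda>x. \<lambda>i\<in>UNIV. x i) = (\<Pi>\<^sub>M i\<in>UNIV. distr (iid_law P) P (\<lambda>\<omega>. \<omega> (i::nat)))"
      unfolding d by (simp add: iid_law_def restrict_UNIV)
  qed (use comp in auto)
  then have ind: "indep_vars (\<lambda>_. borel) (\<lambda>i \<omega>. \<omega> i :: real) (UNIV :: nat set)"
    by (rule indep_vars_compose2) (rule borel_probs_measurable_id[OF P])
  have "distr (iid_law P) borel (\<lambda>\<omega>. \<omega> i) = distr P borel (\<lambda>x. x)" for i :: nat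
    using distr_distr[OF borel_probs_measurable_id[OF P] comp[of i]] by (simp add: d comp_def)
  then show ?thesis
    using ps ind sp by (simp add: iid_unit_samples_def iid_unit_samples_axioms_def)
qed

text \<open>By the formula through distribution functions, sqrt N times the Wasserstein distance is
  the integral of |G|. For N = 0 the empirical measure would be the null measure.\<close>

lemma mem_conf_region_iff:
  assumes P: "P \<in> borel_probs" and N: "N > 0" and w: "\<omega> \<in> space (iid_law P)"
  shows "P \<in> conf_region N \<omega> \<alpha> \<longleftrightarrow>
    (\<integral>x. \<bar>iid_unit_samples.G (iid_law P) (\<lambda>i \<omega>. \<omega> i) N x \<omega>\<bar> \<partial>unif01) \<le> conf_factor \<alpha>"
proof -
  interpret iid_unit_samples "iid_law P" "\<lambda>i \<omega>. \<omega> i" by (rule iid_law_iid_unit_samples[OF P])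
  have r: "\<omega> i \<in> {0..1}" for i using unit_range[OF w] .
  have F: "F x = icdf P x" for x
  proof -
    have comp: "(\<lambda>\<omega>. \<omega> 0) \<in> iid_law P \<rightarrow>\<^sub>M P"
      unfolding iid_law_def by (rule measurable_component_singleton) simp
    have "distr (iid_law P) P (\<lambda>\<omega>. \<omega> 0) = P"
      unfolding iid_law_def using borel_probsD(1)[OF P] by (intro distr_PiM_component) auto
    then have "distr (iid_law P) borel (\<lambda>\<omega>. \<omega> 0) = distr P borel (\<lambda>x. x)"
      using distr_distr[OF borel_probs_measurable_id[OF P] comp] by (simp add: comp_def)
    then show ?thesis by (simp add: F_def)
  qed
  have "\<bar>G N x \<omega>\<bar> = sqrt (real N) * \<bar>icdf (empirical_measure N \<omega>) x - icdf P x\<bar>" for x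
  proof -
    have "(\<Sum>i<N. indicat_real {..x} (\<omega> i)) = (\<Sum>i<N. if \<omega> i \<le> x then 1 else 0)"
      by (intro sum.cong) (auto simp: indicator_def)
    then have "icdf (empirical_measure N \<omega>) x = (\<Sum>i<N. if \<omega> i \<le> x then 1 else 0) / real N"
      using icdf_empirical_measure[OF N r] by simp
    then have "icdf (empirical_measure N \<omega>) x - icdf P x = (\<Sum>i<N. step x (\<omega> i)) / real N"
      using N by (simp add: step_def F sum_subtractf diff_divide_distrib)
    moreover have "G N x \<omega> = sqrt (real N) * ((\<Sum>i<N. step x (\<omega> i)) / real N)"
      using N by (simp add: G_def norm_sum_def real_div_sqrt field_simps)
    ultimately show ?thesis by (simp add: abs_mult)
  qed
  then have "(\<integral>x. \<bar>G N x \<omega>\<bar> \<partial>unif01) = sqrt (real N) * wasserstein (empirical_measure N \<omega>) P"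
    by (simp add: wasserstein_eq_integral_cdf[OF empirical_measure_in_borel_probs[OF N r] P])
  moreover have "real N powr (- 1 / 2) = 1 / sqrt (real N)"
    using N by (simp add: powr_minus_divide powr_half_sqrt)
  moreover have "w \<le> k * (1 / sqrt (real N)) \<longleftrightarrow> sqrt (real N) * w \<le> k" for w k :: real
    using N by (simp add: pos_le_divide_eq mult.commute)
  ultimately show ?thesis
    using P by (simp only: conf_region_def mem_Collect_eq simp_thms)
qed

section \<open>The normal quantile\<close>

text \<open>The variable z = 2 k, twice \<open>conf_factor\<close>.\<close>

definition normal_quantile :: "real \<Rightarrow> real" where
  "normal_quantile \<alpha> = inv std_normal_cdf ((1 + \<alpha>) / 2)"

text \<open>The equation holds for \<open>inv\<close> because the value is attained, by the
  intermediate value theorem between the limits 0 and 1.\<close>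

lemma std_normal_cdf_normal_quantile:
  assumes "\<alpha> \<in> {0..<1}"
  shows "std_normal_cdf (normal_quantile \<alpha>) = (1 + \<alpha>) / 2"
proof -
  have y: "0 < (1 + \<alpha>) / 2" "(1 + \<alpha>) / 2 < 1" using assms by auto
  have "\<forall>\<^sub>F x in at_bot. std_normal_cdf x < (1 + \<alpha>) / 2"
    by (rule order_tendstoD(2)[OF std_normal.cdf_lim_at_bot y(1)])
  then obtain a where a: "\<And>x. x \<le> a \<Longrightarrow> std_normal_cdf x < (1 + \<alpha>) / 2" by (auto simp: eventually_at_bot_linorder)
  have "\<forall>\<^sub>F x in at_top. (1 + \<alpha>) / 2 < std_normal_cdf x"
    by (rule order_tendstoD(1)[OF std_normal.cdf_lim_at_top_prob y(2)])
  then obtain b where b: "\<And>x. x \<ge> b \<Longrightarrow> (1 + \<alpha>) / 2 < std_normal_cdf x" by (auto simp: eventually_at_top_linorder)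
  have "\<exists>x\<ge>min a b. x \<le> b \<and> std_normal_cdf x = (1 + \<alpha>) / 2"
    using a[of "min a b"] b[of b] isCont_std_normal_cdf by (intro IVT) auto
  then obtain x where "std_normal_cdf x = (1 + \<alpha>) / 2" by blast
  then have "(1 + \<alpha>) / 2 \<in> range std_normal_cdf" by (metis rangeI)
  then show ?thesis unfolding normal_quantile_def by (rule f_inv_into_f)
qed

lemma isCont_normal_quantile:
  assumes "\<alpha> \<in> {0..<1}"
  shows "isCont normal_quantile \<alpha>"
proof -
  have inj: "inj std_normal_cdf"
    using strict_mono_std_normal_cdf by (rule strict_mono_imp_inj_on)
  let ?x = "normal_quantile \<alpha>"
  have "isCont (inv std_normal_cdf) (std_normal_cdf ?x)"
    by (rule isCont_inverse_function[where d=1])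
      (auto simp: inv_f_f[OF inj] isCont_std_normal_cdf)
  then have "isCont (inv std_normal_cdf) ((1 + \<alpha>) / 2)"
    by (simp only: std_normal_cdf_normal_quantile[OF assms])
  then have "isCont (\<lambda>\<alpha>. inv std_normal_cdf ((1 + \<alpha>) / 2)) \<alpha>"
    by (rule isCont_o2[where f="\<lambda>\<alpha>. (1 + \<alpha>) / 2", rotated]) (intro continuous_intros, simp)
  then show ?thesis by (simp add: normal_quantile_def[abs_def])
qed

lemma eventually_at_left_1: "\<forall>\<^sub>F \<alpha> in at_left 1. \<alpha> \<in> {0..<1::real}"
  using eventually_at_left_real[of 0 1] by (auto elim: eventually_mono)

lemma filterlim_normal_quantile: "filterlim normal_quantile at_top (at_left 1)"
  unfolding filterlim_at_top
proof
  fix C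
  have "((\<lambda>\<alpha>::real. (1 + \<alpha>) / 2) \<longlongrightarrow> (1 + 1) / 2) (at_left 1)"
    by (intro tendsto_intros) simp
  then have "((\<lambda>\<alpha>::real. (1 + \<alpha>) / 2) \<longlongrightarrow> 1) (at_left 1)" by simp
  from order_tendstoD(1)[OF this std_normal_cdf_less_1[of C]] eventually_at_left_1
  show "\<forall>\<^sub>F \<alpha> in at_left 1. C \<le> normal_quantile \<alpha>"
  proof eventually_elim
    case (elim \<alpha>)
    then have "std_normal_cdf C < std_normal_cdf (normal_quantile \<alpha>)"
      by (simp only: std_normal_cdf_normal_quantile)
    then show ?case
      using strict_mono_less[OF strict_mono_std_normal_cdf] by (simp add: less_imp_le)
  qed
qed

section \<open>Continuity and asymptotics of the defect\<close>

lemma isCont_tail_bound: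
  assumes "0 < z"
  shows "isCont tail_bound z"
proof -
  have s: "isCont shrink z" "isCont spread z"
    unfolding shrink_def[abs_def] spread_def[abs_def] using assms by (auto intro!: continuous_intros)
  have "0 < spread z" using assms by (simp add: spread_def)
  then have g: "isCont gain z"
    unfolding gain_def[abs_def] using s by (auto intro!: continuous_intros)
  have "isCont (\<lambda>z. std_normal_cdf (z - shrink z)) z"
    using s by (intro isCont_o2[OF _ isCont_std_normal_cdf] continuous_intros)
  then show ?thesis
    unfolding tail_bound_def[abs_def] gauss_err_def[abs_def] using s g by (intro continuous_intros) auto
qed

lemma tail_bound_nonneg: "0 \<le> tail_bound z"
  using std_normal_cdf_less_1[of "z - shrink z"] gauss_err_nonneg[of z] by (simp add: tail_bound_def)

text \<open>
  For large quantiles the defect is \<^const>\<open>tail_bound\<close>; the summand \<open>max 0 (z0 + 1 - z)\<close> makes it trivial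
  below \<open>z0\<close> without losing continuity.
\<close>

definition defect :: "real \<Rightarrow> real \<Rightarrow> real" where
  "defect z0 \<alpha> = (if \<alpha> < 1 then
     min 1 (tail_bound (max z0 (normal_quantile \<alpha>)) + max 0 (z0 + 1 - normal_quantile \<alpha>)) else 0)"

lemma defect_bounds: "0 \<le> defect z0 \<alpha>" "defect z0 \<alpha> \<le> 1"
  using tail_bound_nonneg by (auto simp: defect_def)

text \<open>Near 1 the quantile is so large that \<open>min\<close> and both \<open>max\<close> are
  inactive, and \<open>2 * (1 - std_normal_cdf z)\<close> is 1 - \<alpha>; the claim is then
  \<open>tail_bound_asymp\<close> along the quantile.\<close>

lemma defect_asymp: "((\<lambda>\<alpha>. defect z0 \<alpha> / (1 - \<alpha>)) \<longlongrightarrow> 1) (at_left 1)"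
proof -
  have "((\<lambda>z. 2 * (1 - std_normal_cdf z)) \<longlongrightarrow> 2 * (1 - 1)) at_top"
    by (intro tendsto_intros std_normal.cdf_lim_at_top_prob)
  from tendsto_mult[OF tail_bound_asymp this]
  have "((\<lambda>z. tail_bound z / (2 * (1 - std_normal_cdf z)) * (2 * (1 - std_normal_cdf z))) \<longlongrightarrow> 0) at_top" by simp
  moreover have "tail_bound z / (2 * (1 - std_normal_cdf z)) * (2 * (1 - std_normal_cdf z)) = tail_bound z" for z
    using std_normal_cdf_less_1[of z] by simp
  ultimately have "(tail_bound \<longlongrightarrow> 0) at_top" by (simp only:)
  then have "\<forall>\<^sub>F z in at_top. tail_bound z < 1"
    by (rule order_tendstoD(2)) simp
  then have ev: "\<forall>\<^sub>F z in at_top. tail_bound z < 1 \<and> z0 + 1 \<le> z"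
    using eventually_ge_at_top[of "z0 + 1"] by eventually_elim auto
  have lim: "((\<lambda>\<alpha>. tail_bound (normal_quantile \<alpha>) / (2 * (1 - std_normal_cdf (normal_quantile \<alpha>)))) \<longlongrightarrow> 1) (at_left 1)"
    by (rule filterlim_compose[OF tail_bound_asymp filterlim_normal_quantile])
  have "\<forall>\<^sub>F \<alpha> in at_left 1. tail_bound (normal_quantile \<alpha>) / (2 * (1 - std_normal_cdf (normal_quantile \<alpha>)))
    = defect z0 \<alpha> / (1 - \<alpha>)"
    using eventually_compose_filterlim[OF ev filterlim_normal_quantile] eventually_at_left_1
  proof eventually_elim
    case (elim \<alpha>)
    then have "2 * (1 - std_normal_cdf (normal_quantile \<alpha>)) = 1 - \<alpha>"
      unfolding std_normal_cdf_normal_quantile[OF elim(2)] by (simp add: field_simps)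
    moreover have "defect z0 \<alpha> = tail_bound (normal_quantile \<alpha>)"
      using elim by (simp add: defect_def max_absorb2)
    ultimately show ?case by (simp only:)
  qed
  then show ?thesis using lim by (rule Lim_transform_eventually[rotated])
qed

lemma continuous_on_defect:
  assumes z0: "0 < z0"
  shows "continuous_on {0..1} (defect z0)"
  unfolding continuous_on_eq_continuous_within
proof
  fix \<alpha> :: real assume a: "\<alpha> \<in> {0..1}"
  show "continuous (at \<alpha> within {0..1}) (defect z0)"
  proof (cases "\<alpha> < 1")
    case True
    with a have a1: "\<alpha> \<in> {0..<1}" by simp
    let ?g = "\<lambda>\<alpha>. min 1 (tail_bound (max z0 (normal_quantile \<alpha>)) + max 0 (z0 + 1 - normal_quantile \<alpha>))"
    note q = isCont_normal_quantile[OF a1]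
    \<comment> \<open>The \<open>max\<close> keeps the argument of \<open>tail_bound\<close> at
      least z0 > 0, where it is continuous.\<close>
    have "isCont (\<lambda>\<alpha>. tail_bound (max z0 (normal_quantile \<alpha>))) \<alpha>"
      using z0 q by (intro isCont_o2[OF _ isCont_tail_bound] continuous_intros) auto
    then have "isCont ?g \<alpha>" using q by (intro continuous_intros)
    moreover have "\<forall>\<^sub>F b in nhds \<alpha>. defect z0 b = ?g b"
      using eventually_nhds_in_open[of "{..<1}" \<alpha>] True by (auto simp: defect_def elim: eventually_mono)
    ultimately have "isCont (defect z0) \<alpha>" by (simp add: isCont_cong)
    then show ?thesis by (rule continuous_at_imp_continuous_at_within)
  next
    case False
    with a have a1: "\<alpha> = 1" by simp
    \<comment> \<open>At 1 the asymptotics force the limit 0, which is the value chosen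
      there.\<close>
    have "((\<lambda>\<alpha>. defect z0 \<alpha> / (1 - \<alpha>) * (1 - \<alpha>)) \<longlongrightarrow> 1 * (1 - 1)) (at_left 1)"
      by (intro tendsto_mult defect_asymp tendsto_intros)
    moreover have "\<forall>\<^sub>F \<alpha> in at_left 1. defect z0 \<alpha> / (1 - \<alpha>) * (1 - \<alpha>) = defect z0 \<alpha>"
      using eventually_at_left_1 by eventually_elim auto
    ultimately have "(defect z0 \<longlongrightarrow> 0) (at_left 1)"
      by (simp add: tendsto_cong)
    then show ?thesis
      unfolding a1 continuous_within by (simp add: at_within_Icc_at_left defect_def)
  qed
qed

section \<open>Coverage of the confidence region\<close>

lemma liminf_conf_region_ge:
  assumes P: "P \<in> borel_probs" and z: "0 < normal_quantile \<alpha>"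
    "shrink (normal_quantile \<alpha>) < normal_quantile \<alpha>" "1 \<le> gain (normal_quantile \<alpha>)"
  shows "ereal (1 - tail_bound (normal_quantile \<alpha>)) \<le> liminf (\<lambda>N. ereal (measure (iid_law P)
    {\<omega> \<in> space (iid_law P). P \<in> conf_region N \<omega> \<alpha>}))"
proof -
  interpret iid_unit_samples "iid_law P" "\<lambda>i \<omega>. \<omega> i" by (rule iid_law_iid_unit_samples[OF P])
  define z where "z = normal_quantile \<alpha>"
  have cf: "conf_factor \<alpha> = z / 2" by (simp add: conf_factor_def z_def normal_quantile_def)
  obtain a L where a: "\<forall>\<^sub>F N in sequentially. prob {\<omega>\<in>space (iid_law P). z / 2 < (\<integral>x. \<bar>G N x \<omega>\<bar> \<partial>unif01)} \<le> a N"
    and L: "a \<longlonglongrightarrow> L" "L \<le> tail_bound z"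
    using prob_integral_abs_gt[OF z] unfolding z_def by blast
  have "\<forall>\<^sub>F N in sequentially. ereal (1 - a N) \<le> ereal (prob {\<omega> \<in> space (iid_law P). P \<in> conf_region N \<omega> \<alpha>})"
    using a eventually_gt_at_top[of 0]
  proof eventually_elim
    case (elim N)
    have "{\<omega> \<in> space (iid_law P). P \<in> conf_region N \<omega> \<alpha>}
      = space (iid_law P) - {\<omega>\<in>space (iid_law P). z / 2 < (\<integral>x. \<bar>G N x \<omega>\<bar> \<partial>unif01)}"
      using mem_conf_region_iff[OF P elim(2)] by (auto simp: cf)
    then have "prob {\<omega> \<in> space (iid_law P). P \<in> conf_region N \<omega> \<alpha>}
      = 1 - prob {\<omega>\<in>space (iid_law P). z / 2 < (\<integral>x. \<bar>G N x \<omega>\<bar> \<partial>unif01)}"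
      by (simp only:) (rule prob_compl, measurable)
    then show ?case using elim(1) by simp
  qed
  then have mono: "liminf (\<lambda>N. ereal (1 - a N)) \<le> liminf (\<lambda>N. ereal (prob {\<omega> \<in> space (iid_law P). P \<in> conf_region N \<omega> \<alpha>}))"
    by (rule Liminf_mono)
  have "(\<lambda>N. ereal (1 - a N)) \<longlonglongrightarrow> ereal (1 - L)"
    by (intro tendsto_ereal tendsto_diff tendsto_const L)
  then have lim: "liminf (\<lambda>N. ereal (1 - a N)) = ereal (1 - L)"
    by (rule lim_imp_Liminf[rotated]) simp
  have "ereal (1 - tail_bound z) \<le> ereal (1 - L)" using L by simp
  also note lim[symmetric]
  also note mono
  finally show ?thesis unfolding z_def .
qed

theorem theorem5p1:
  shows "\<exists>g :: real \<Rightarrow> real.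
    continuous_on {0..1} g \<and> g \<in> {0..1} \<rightarrow> {0..1} \<and>
    ((\<lambda>\<alpha>. g \<alpha> / (1 - \<alpha>)) \<longlongrightarrow> 1) (at_left 1) \<and>
    (\<forall>P \<in> borel_probs. \<forall>\<alpha> \<in> {0..<1}.
      liminf (\<lambda>N. ereal (measure (iid_law P)
        {\<omega> \<in> space (iid_law P). P \<in> conf_region N \<omega> \<alpha>})) \<ge> ereal (1 - g \<alpha>))"
proof -
  obtain z1 where z1: "\<And>z. z \<ge> z1 \<Longrightarrow> 0 < z \<and> shrink z < z \<and> 1 \<le> gain z"
    using eventually_parameters by (auto simp: eventually_at_top_linorder)
  define z0 where "z0 = max 1 z1"
  have "ereal (1 - defect z0 \<alpha>) \<le> liminf (\<lambda>N. ereal (measure (iid_law P)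
        {\<omega> \<in> space (iid_law P). P \<in> conf_region N \<omega> \<alpha>}))"
    if P: "P \<in> borel_probs" and \<alpha>: "\<alpha> \<in> {0..<1}" for P \<alpha>
  proof (cases "z0 \<le> normal_quantile \<alpha>")
    case True
    then have "z1 \<le> normal_quantile \<alpha>" by (simp add: z0_def)
    note z = z1[OF this]
    \<comment> \<open>The extra summand only increases the defect; if the cap 1 is active, the bound
      is the trivial 0.\<close>
    have "ereal (1 - defect z0 \<alpha>) \<le> max (ereal (1 - tail_bound (normal_quantile \<alpha>))) 0"
      using True \<alpha> by (auto simp: defect_def max_absorb2 min_def le_max_iff_disj)
    also have "\<dots> \<le> liminf (\<lambda>N. ereal (measure (iid_law P) {\<omega> \<in> space (iid_law P). P \<in> conf_region N \<omega> \<alpha>}))"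
      using liminf_conf_region_ge[OF P, of \<alpha>] z by (auto intro!: Liminf_bounded)
    finally show ?thesis .
  next
    case False
    \<comment> \<open>Below z0 the summand z0 + 1 - z exceeds 1, so the defect is 1 and nothing is
      claimed.\<close>
    then have "1 \<le> tail_bound (max z0 (normal_quantile \<alpha>)) + max 0 (z0 + 1 - normal_quantile \<alpha>)"
      using tail_bound_nonneg[of "max z0 (normal_quantile \<alpha>)"] by linarith
    then have "defect z0 \<alpha> = 1" using \<alpha> by (simp add: defect_def)
    then show ?thesis by (auto intro!: Liminf_bounded)
  qed
  then show ?thesis
    using continuous_on_defect[of z0] defect_asymp[of z0] defect_bounds[of z0]
    by (intro exI[of _ "defect z0"]) (auto simp: z0_def)
qed

end
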